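(* Let $F$ be a field and let $q,n,e\in\mathbb{N}$ with $q>1$ and $e\mid q^n-1$. Then $$\mathrm{LL}(A(q,n,e))=\left\lfloor \frac{n(q-1)}{m(q,e)}\right\rfloor+1$$ in each of the following cases: (i) $e=p^k$ for an odd prime $p$ and $k\in\mathbb{N}$, and $q\equiv 1\pmod p$; or $e=2p^k$ for an odd prime $p$ and $k\in\mathbb{N}$, and $q\equiv 1\pmod{2p}$; (ii) $e$ is a power of an odd Pierpont prime; (iii) $e$ is a power of $2$.
   Context: $\mathbb{N}$ denotes the set of positive integers, $\mathbb{N}_0=\mathbb{N}\cup\{0\}$. A Pierpont prime is a prime number of the form $1+2^a3^b$ with $a,b\in\mathbb{N}_0$. For $q,e\in\mathbb{N}$ with $\gcd(q,e)=1$, $m(q,e)$ is the smallest positive integer $t$ such that there exist $i_1,\dots,i_t\in\mathbb{N}_0$ (repetitions allowed) with $e\mid q^{i_1}+\dots+q^{i_t}$. For a field $F$ and $q,n,e\in\mathbb{N}$ with $q>1$ and $e\mid q^n-1$, let $I=(X_1^q,\dots,X_n^q)$ in the polynomial algebra $F[X_1,\dots,X_n]$ and $x_j=X_j+I$. Then $A(q,n,e)$ is the unital $F$-subalgebra of $F[x_1,\dots,x_n]=F[X_1,\dots,X_n]/I$ generated by all monomials $x_1^{i_1}\cdots x_n^{i_n}$ with $i_1+qi_2+\dots+q^{n-1}i_n\equiv 0\pmod e$. For a finite-dimensional algebra $A$ with Jacobson radical $\mathrm{J}(A)$, the Loewy length $\mathrm{LL}(A)$ is the smallest $l\in\mathbb{N}_0$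 with $\mathrm{J}(A)^l=0$. *)

theory Defs
  imports
    "HOL-Algebra.Embedded_Algebras"
    "HOL-Algebra.QuotRing"
    "HOL-Algebra.Ideal_Product"
    "HOL-Algebra.Algebraic_Closure_Type"
    "HOL-Number_Theory.Cong"
    "HOL-Library.Poly_Mapping"
begin

text \<open>Exponent vectors of monomials in \<open>X\<^sub>1, X\<^sub>2, \<dots>\<close>, and polynomials over \<open>'a\<close>
  as finitely supported families of coefficients, multiplied by convolution.\<close>

type_synonym expo = "nat \<Rightarrow>\<^sub>0 nat"
type_synonym 'a mpoly = "expo \<Rightarrow>\<^sub>0 'a"

definition monomial :: "expo \<Rightarrow> 'a::field mpoly" where
  "monomial i = Poly_Mapping.single i 1"

definition scalar :: "'a::field \<Rightarrow> 'a mpoly" where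
  "scalar c = Poly_Mapping.single 0 c"

definition mvar :: "nat \<Rightarrow> 'a::field mpoly" where
  "mvar j = monomial (Poly_Mapping.single j 1)"

text \<open>The ring \<open>F[X\<^sub>1,\<dots>,X\<^sub>n]\<close>, where the field \<open>F\<close> is the type \<open>'a\<close>.\<close>

definition mpoly_ring :: "nat \<Rightarrow> 'a::field mpoly ring" where
  "mpoly_ring n =
     ring_of_type_algebra \<lparr>carrier := {f. \<forall>i \<in> Poly_Mapping.keys f. Poly_Mapping.keys i \<subseteq> {1..n}}\<rparr>"

definition trunc_ideal :: "nat \<Rightarrow> nat \<Rightarrow> 'a::field mpoly set" where
  "trunc_ideal q n = Idl\<^bsub>mpoly_ring n\<^esub> {mvar j ^ q | j. j \<in> {1..n}}"

definition trunc_ring :: "nat \<Rightarrow> nat \<Rightarrow> 'a::field mpoly set ring" where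
  "trunc_ring q n = mpoly_ring n Quot trunc_ideal q n"

definition residue_class :: "nat \<Rightarrow> nat \<Rightarrow> 'a::field mpoly \<Rightarrow> 'a mpoly set" where
  "residue_class q n f = trunc_ideal q n +>\<^bsub>mpoly_ring n\<^esub> f"

definition base_field :: "nat \<Rightarrow> nat \<Rightarrow> 'a::field mpoly set set" where
  "base_field q n = range (\<lambda>c. residue_class q n (scalar c))"

definition generators :: "nat \<Rightarrow> nat \<Rightarrow> nat \<Rightarrow> 'a::field mpoly set set" where
  "generators q n e =
     {residue_class q n (monomial i) | i. Poly_Mapping.keys i \<subseteq> {1..n} \<and>
        [(\<Sum>j = 1..n. q ^ (j - 1) * Poly_Mapping.lookup i j) = 0] (mod e)}"

text \<open>The algebra \<open>A(q,n,e)\<close>. The library's \<open>subalgebra\<close> only expresses being a linear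
  subspace, so closure under multiplication and the unit come from \<open>subring\<close>.\<close>

definition fixpoint_algebra :: "nat \<Rightarrow> nat \<Rightarrow> nat \<Rightarrow> 'a::field mpoly set ring" where
  "fixpoint_algebra q n e = (trunc_ring q n)
     \<lparr>carrier := \<Inter>{V. subring V (trunc_ring q n)
        \<and> subalgebra (base_field q n) V (trunc_ring q n) \<and> generators q n e \<subseteq> V}\<rparr>"

text \<open>The Jacobson radical and the Loewy length are only used for the commutative algebras
  \<open>A(q,n,e)\<close>, so one-sided ideals are not needed.\<close>

definition jacobson_radical :: "('b, 'c) ring_scheme \<Rightarrow> 'b set" where
  "jacobson_radical R = carrier R \<inter> \<Inter>{M. maximalideal M R}"

primrec ideal_power :: "('b, 'c) ring_scheme \<Rightarrow> 'b set \<Rightarrow> nat \<Rightarrow> 'b set" where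
  "ideal_power R J 0 = carrier R"
| "ideal_power R J (Suc l) = ideal_prod R (ideal_power R J l) J"

definition loewy_length :: "('b, 'c) ring_scheme \<Rightarrow> nat" where
  "loewy_length R = (LEAST l. ideal_power R (jacobson_radical R) l = {\<zero>\<^bsub>R\<^esub>})"

text \<open>The number \<open>m(q,e)\<close>, meaningful for coprime \<open>q\<close> and \<open>e\<close>.\<close>

definition min_powers :: "nat \<Rightarrow> nat \<Rightarrow> nat" where
  "min_powers q e = (LEAST t. t > 0 \<and> (\<exists>i :: nat \<Rightarrow> nat. e dvd (\<Sum>s = 1..t. q ^ i s)))"

definition pierpont_prime :: "nat \<Rightarrow> bool" where
  "pierpont_prime p \<longleftrightarrow> prime p \<and> (\<exists>a b :: nat. p = 1 + 2 ^ a * 3 ^ b)"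

end

theory Submission
  imports Defs "HOL-Number_Theory.Pocklington"
begin

text \<open>The algebra has a basis of monomials, and its radical is spanned by the nonconstant ones, so
  the Loewy length is one more than the largest number of nonzero exponent vectors of weight
  divisible by \<open>e\<close> whose sum has all entries below \<open>q\<close>. Every such vector has degree at least
  \<open>m = m(q,e)\<close>, which bounds this number by \<open>n (q - 1) / m\<close>. In all the cases considered the bound is
  attained exactly: the multiset containing every position in \<open>{0..<n}\<close> exactly \<open>q - 1\<close> times
  splits into cyclic shifts of a single block of \<open>m\<close> positions \<open>b r\<close> with
  \<open>e dvd (\<Sum>r<m. q ^ b r)\<close>. If \<open>m\<close> divides \<open>q - 1\<close>, all shifts are used; if \<open>e\<close> is a power of
  \<open>2\<close> and \<open>m = 4\<close>, the block has two even and two odd positions and the even shifts are used; if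
  \<open>q\<close> has order divisible by \<open>m = 2\<close> or \<open>m = 3\<close> modulo \<open>p\<close>, the block is an arithmetic progression
  whose powers of \<open>q\<close> are the \<open>m\<close>-th roots of unity.\<close>

section \<open>The truncated polynomial ring\<close>

text \<open>All ideals, subrings and filtration pieces below are spanned by monomials, or are images
  of such spans, so each is encoded by its set of exponents. Closure under products becomes closure
  of that set under addition.\<close>

definition supported :: "expo set \<Rightarrow> 'a::field mpoly set" where
  "supported M = {f. Poly_Mapping.keys f \<subseteq> M}"

lemma supported_mono: "M \<subseteq> N \<Longrightarrow> supported M \<subseteq> supported N"
  by (auto simp: supported_def)

lemma zero_supported [simp]: "0 \<in> supported M"
  by (simp add: supported_def)

lemma single_supported: "a \<in> M \<Longrightarrow> Poly_Mapping.single a c \<in> supported M"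
  by (simp add: supported_def)

lemma one_supported: "0 \<in> M \<Longrightarrow> 1 \<in> supported M"
  by (simp add: supported_def)

lemma add_supported: "f \<in> supported M \<Longrightarrow> g \<in> supported M \<Longrightarrow> f + g \<in> supported M"
  using Poly_Mapping.keys_add[of f g] by (auto simp: supported_def)

lemma uminus_supported: "f \<in> supported M \<Longrightarrow> - f \<in> supported M"
  by (auto simp: supported_def in_keys_iff)

lemma diff_supported: "f \<in> supported M \<Longrightarrow> g \<in> supported M \<Longrightarrow> f - g \<in> supported M"
  using add_supported[OF _ uminus_supported, of f M g] by simp

lemma mult_supported:
  assumes "f \<in> supported M" "g \<in> supported N" "\<And>a b. a \<in> M \<Longrightarrow> b \<in> N \<Longrightarrow> a + b \<in> K"
  shows "f * g \<in> supported K"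
  using Poly_Mapping.keys_mult[of f g] assms by (fastforce simp: supported_def)

lemma supported_induct [consumes 1, case_names zero single add]:
  assumes "f \<in> supported M" "P 0"
    and "\<And>a c. a \<in> M \<Longrightarrow> P (Poly_Mapping.single a c)"
    and "\<And>f g. f \<in> supported M \<Longrightarrow> g \<in> supported M \<Longrightarrow> P f \<Longrightarrow> P g \<Longrightarrow> P (f + g)"
  shows "P f"
proof -
  \<comment> \<open>Membership in \<open>supported M\<close> is carried along because the premise
    for sums asks for it on both summands.\<close>
  have "P (\<Sum>a\<in>A. Poly_Mapping.single a (Poly_Mapping.lookup f a)) \<and>
      (\<Sum>a\<in>A. Poly_Mapping.single a (Poly_Mapping.lookup f a)) \<in> supported M"
    if "finite A" "A \<subseteq> M" for A
    using that by (induction A rule: finite_induct)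
      (auto intro!: assms(2-4) add_supported single_supported)
  moreover have "f = (\<Sum>a\<in>Poly_Mapping.keys f. Poly_Mapping.single a (Poly_Mapping.lookup f a))"
    by (rule poly_mapping_eqI)
      (auto simp: lookup_sum lookup_single when_def in_keys_iff if_distrib cong: if_cong)
  ultimately show ?thesis
    using assms(1) by (metis finite_keys mem_Collect_eq supported_def)
qed

definition var_expos :: "nat \<Rightarrow> expo set" where
  "var_expos n = {i. Poly_Mapping.keys i \<subseteq> {1..n}}"

lemma zero_var_expos [simp]: "0 \<in> var_expos n"
  by (simp add: var_expos_def)

lemma add_var_expos: "i \<in> var_expos n \<Longrightarrow> j \<in> var_expos n \<Longrightarrow> i + j \<in> var_expos n"
  using Poly_Mapping.keys_add[of i j] by (auto simp: var_expos_def)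

lemma mpoly_ring_simps [simp]:
  "carrier (mpoly_ring n) = supported (var_expos n)"
  "f \<otimes>\<^bsub>mpoly_ring n\<^esub> g = f * g" "f \<oplus>\<^bsub>mpoly_ring n\<^esub> g = f + g"
  "\<one>\<^bsub>mpoly_ring n\<^esub> = 1" "\<zero>\<^bsub>mpoly_ring n\<^esub> = 0"
  by (auto simp: mpoly_ring_def ring_of_type_algebra_def supported_def var_expos_def)

lemma mult_mpoly_carrier:
  "f \<in> supported (var_expos n) \<Longrightarrow> g \<in> supported (var_expos n) \<Longrightarrow> f * g \<in> supported (var_expos n)"
  by (rule mult_supported) (auto intro: add_var_expos)

lemma mpoly_ring_cring: "cring (mpoly_ring n :: 'a::field mpoly ring)"
proof (rule cringI)
  show "abelian_group (mpoly_ring n :: 'a mpoly ring)"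
    by (rule abelian_groupI)
      (auto simp: algebra_simps intro!: add_supported bexI[of _ "- x" for x] uminus_supported)
  show "comm_monoid (mpoly_ring n :: 'a mpoly ring)"
    by (rule comm_monoidI) (auto simp: algebra_simps intro!: mult_mpoly_carrier one_supported)
qed (auto simp: algebra_simps)

lemma mpoly_ring_a_inv:
  assumes "f \<in> supported (var_expos n)"
  shows "\<ominus>\<^bsub>mpoly_ring n\<^esub> f = - f"
proof -
  interpret cring "mpoly_ring n" by (rule mpoly_ring_cring)
  show ?thesis
    by (rule minus_equality) (auto simp: assms uminus_supported)
qed

section \<open>The truncation ideal and its quotient\<close>

definition large_expos :: "nat \<Rightarrow> nat \<Rightarrow> expo set" where
  "large_expos q n = {i \<in> var_expos n. \<exists>j. q \<le> Poly_Mapping.lookup i j}"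

lemma mvar_power: "mvar j ^ k = (Poly_Mapping.single (Poly_Mapping.single j k) 1 :: 'a::field mpoly)"
  by (induction k) (auto simp: mvar_def monomial_def mult_single single_add[symmetric])

lemma trunc_ideal_ideal:
  "ideal (trunc_ideal q n) (mpoly_ring n :: 'a::field mpoly ring)"
  unfolding trunc_ideal_def
proof (rule ring.genideal_ideal[OF cring.axioms(1)[OF mpoly_ring_cring]])
  show "{mvar j ^ q | j. j \<in> {1..n}} \<subseteq> carrier (mpoly_ring n :: 'a mpoly ring)"
    by (auto simp: mvar_power var_expos_def intro!: single_supported split: if_splits)
qed

text \<open>A monomial ideal is spanned by the multiples of its generators. One inclusion is
  minimality of the generated ideal; for the other, every term with an exponent at least
  \<open>q\<close> is a multiple of some \<open>mvar j ^ q\<close>.\<close>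

lemma trunc_ideal_eq:
  assumes "q > 0"
  shows "trunc_ideal q n = (supported (large_expos q n) :: 'a::field mpoly set)"
proof
  let ?R = "mpoly_ring n :: 'a mpoly ring"
  let ?G = "{mvar j ^ q | j. j \<in> {1..n}} :: 'a mpoly set"
  interpret cring ?R by (rule mpoly_ring_cring)
  have add: "i + j \<in> large_expos q n" if "i \<in> var_expos n" "j \<in> large_expos q n" for i j
    using that by (auto simp: large_expos_def lookup_add intro: add_var_expos trans_le_add2)
  have sub: "(supported (large_expos q n) :: 'a mpoly set) \<subseteq> supported (var_expos n)"
    by (rule supported_mono) (auto simp: large_expos_def)
  show "trunc_ideal q n \<subseteq> (supported (large_expos q n) :: 'a mpoly set)"
    unfolding trunc_ideal_def
  proof (rule genideal_minimal)
    show "ideal (supported (large_expos q n)) ?R"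
    proof (rule idealI)
      show "subgroup (supported (large_expos q n)) (add_monoid ?R)"
      proof (rule add.subgroupI)
        show "\<ominus>\<^bsub>?R\<^esub> f \<in> supported (large_expos q n)" if "f \<in> supported (large_expos q n)" for f
          using that sub by (simp add: mpoly_ring_a_inv uminus_supported subset_iff)
      qed (use sub in \<open>auto intro: add_supported zero_supported\<close>)
      fix f g :: "'a mpoly"
      assume f: "f \<in> supported (large_expos q n)" and "g \<in> carrier ?R"
      then have "g * f \<in> supported (large_expos q n)"
        using add by (auto intro: mult_supported)
      then show "g \<otimes>\<^bsub>?R\<^esub> f \<in> supported (large_expos q n)" "f \<otimes>\<^bsub>?R\<^esub> g \<in> supported (large_expos q n)"
        by (simp_all add: mult.commute)
    qed (rule local.ring_axioms)
    show "?G \<subseteq> supported (large_expos q n)"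
    proof (clarsimp simp: mvar_power)
      fix j assume j: "Suc 0 \<le> j" "j \<le> n"
      have "q \<le> Poly_Mapping.lookup (Poly_Mapping.single j q) j" by simp
      then show "Poly_Mapping.single (Poly_Mapping.single j q) 1 \<in> (supported (large_expos q n) :: 'a mpoly set)"
        using j unfolding large_expos_def by (auto simp: var_expos_def intro!: single_supported exI[of _ j] split: if_splits)
    qed
  qed
  interpret I: ideal "trunc_ideal q n" ?R by (rule trunc_ideal_ideal)
  show "(supported (large_expos q n) :: 'a mpoly set) \<subseteq> trunc_ideal q n"
  proof
    fix f :: "'a mpoly" assume "f \<in> supported (large_expos q n)"
    then show "f \<in> trunc_ideal q n"
    proof (induction rule: supported_induct)
      case zero
      show ?case using I.zero_closed by simp
    next
      case (single a c)
      then obtain j where j: "q \<le> Poly_Mapping.lookup a j" and a: "a \<in> var_expos n"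
        by (auto simp: large_expos_def)
      \<comment> \<open>As \<open>q > 0\<close>, the exponent of this variable is nonzero, so it is
        one of the \<open>n\<close> variables of the ring.\<close>
      have j_in: "j \<in> {1..n}"
        using a j assms by (auto simp: var_expos_def in_keys_iff subset_iff)
      have sum: "(a - Poly_Mapping.single j q) + Poly_Mapping.single j q = a"
        by (rule poly_mapping_eqI) (use j in \<open>auto simp: lookup_add lookup_minus lookup_single when_def\<close>)
      have "mvar j ^ q \<in> (trunc_ideal q n :: 'a mpoly set)"
      proof -
        have "?G \<subseteq> carrier ?R"
          by (auto simp: mvar_power var_expos_def intro!: single_supported split: if_splits)
        from genideal_self[OF this] j_in show ?thesis by (auto simp: trunc_ideal_def)
      qed
      moreover have "Poly_Mapping.single (a - Poly_Mapping.single j q) c \<in> carrier ?R"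
        using a by (auto simp: var_expos_def in_keys_iff lookup_minus subset_iff intro!: single_supported)
      ultimately have "Poly_Mapping.single (a - Poly_Mapping.single j q) c \<otimes>\<^bsub>?R\<^esub> mvar j ^ q \<in> trunc_ideal q n"
        by (rule I.I_l_closed)
      then show ?case
        by (simp add: mvar_power mult_single sum)
    next
      case (add f g)
      then show ?case using I.a_closed by simp
    qed
  qed
qed

lemma residue_class_hom:
  "ring_hom_ring (mpoly_ring n) (trunc_ring q n) (residue_class q n :: 'a::field mpoly \<Rightarrow> _)"
  unfolding trunc_ring_def residue_class_def
  by (rule ideal.rcos_ring_hom_ring[OF trunc_ideal_ideal])

lemma trunc_ring_cring: "cring (trunc_ring q n :: 'a::field mpoly set ring)"
  unfolding trunc_ring_def
  by (rule ideal.quotient_is_cring[OF trunc_ideal_ideal mpoly_ring_cring])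

lemma
  fixes f g :: "'a::field mpoly"
  assumes "f \<in> supported (var_expos n)" "g \<in> supported (var_expos n)"
  shows residue_class_add:
      "residue_class q n f \<oplus>\<^bsub>trunc_ring q n\<^esub> residue_class q n g = residue_class q n (f + g)"
    and residue_class_mult:
      "residue_class q n f \<otimes>\<^bsub>trunc_ring q n\<^esub> residue_class q n g = residue_class q n (f * g)"
  using ring_hom_add[OF ring_hom_ring.homh[OF residue_class_hom], of f n g q]
    ring_hom_mult[OF ring_hom_ring.homh[OF residue_class_hom], of f n g q] assms by simp_all

lemma residue_class_zero: "residue_class q n 0 = \<zero>\<^bsub>trunc_ring q n :: 'a::field mpoly set ring\<^esub>"
  and residue_class_one: "residue_class q n 1 = \<one>\<^bsub>trunc_ring q n :: 'a::field mpoly set ring\<^esub>"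
proof -
  interpret ring_hom_ring "mpoly_ring n" "trunc_ring q n" "residue_class q n :: 'a mpoly \<Rightarrow> _"
    by (rule residue_class_hom)
  show "residue_class q n 0 = \<zero>\<^bsub>trunc_ring q n :: 'a mpoly set ring\<^esub>"
    "residue_class q n 1 = \<one>\<^bsub>trunc_ring q n :: 'a mpoly set ring\<^esub>"
    using hom_zero hom_one by simp_all
qed

lemma residue_class_eq_zero_iff:
  fixes f :: "'a::field mpoly"
  assumes "q > 0" "f \<in> supported (var_expos n)"
  shows "residue_class q n f = \<zero>\<^bsub>trunc_ring q n\<^esub> \<longleftrightarrow> f \<in> supported (large_expos q n)"
proof -
  interpret I: ideal "trunc_ideal q n" "mpoly_ring n :: 'a mpoly ring" by (rule trunc_ideal_ideal)
  have "residue_class q n f = trunc_ideal q n \<longleftrightarrow> f \<in> trunc_ideal q n"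
    unfolding residue_class_def using I.a_rcos_const I.a_rcos_self assms by (metis mpoly_ring_simps(1))
  then show ?thesis
    by (simp add: trunc_ring_def FactRing_def trunc_ideal_eq[OF assms(1)])
qed

lemma residue_class_eqD:
  fixes f g :: "'a::field mpoly"
  assumes "q > 0" "f \<in> supported (var_expos n)" "g \<in> supported (var_expos n)"
    and "residue_class q n f = residue_class q n g"
  shows "f - g \<in> supported (large_expos q n)"
proof -
  have "residue_class q n (f - g) = residue_class q n (g - g)"
    using assms residue_class_add[of f n "- g" q] residue_class_add[of g n "- g" q]
    by (simp add: uminus_supported)
  then show ?thesis
    using residue_class_eq_zero_iff[of q "f - g" n] assms by (simp add: residue_class_zero diff_supported)
qed

section \<open>The subalgebra spanned by monomials of weight divisible by e\<close>

definition fixed_expos :: "nat \<Rightarrow> nat \<Rightarrow> nat \<Rightarrow> expo set" where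
  "fixed_expos q n e =
     {i \<in> var_expos n. [(\<Sum>j = 1..n. q ^ (j - 1) * Poly_Mapping.lookup i j) = 0] (mod e)}"

lemma zero_fixed_expos [simp]: "0 \<in> fixed_expos q n e"
  by (simp add: fixed_expos_def)

lemma add_fixed_expos:
  "i \<in> fixed_expos q n e \<Longrightarrow> j \<in> fixed_expos q n e \<Longrightarrow> i + j \<in> fixed_expos q n e"
  by (auto simp: fixed_expos_def lookup_add distrib_left sum.distrib cong_0_iff intro: add_var_expos)

lemma fixed_expos_subset: "fixed_expos q n e \<subseteq> var_expos n"
  by (auto simp: fixed_expos_def)

lemma supported_fixed_subset:
  "M \<subseteq> fixed_expos q n e \<Longrightarrow> f \<in> supported M \<Longrightarrow> f \<in> supported (var_expos n)"
  using supported_mono[of M "var_expos n"] fixed_expos_subset by blast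

lemma supported_fixed_subring:
  "subring (residue_class q n ` supported (fixed_expos q n e))
     (trunc_ring q n :: 'a::field mpoly set ring)"
proof -
  let ?R = "mpoly_ring n :: 'a mpoly ring"
  interpret ring_hom_ring ?R "trunc_ring q n" "residue_class q n"
    by (rule residue_class_hom)
  have "subring (supported (fixed_expos q n e)) ?R"
  proof (rule R.subringI)
    show sub: "supported (fixed_expos q n e) \<subseteq> carrier ?R"
      using supported_mono[OF fixed_expos_subset] by simp
    show "\<ominus>\<^bsub>?R\<^esub> f \<in> supported (fixed_expos q n e)" if "f \<in> supported (fixed_expos q n e)" for f
      using that sub by (simp add: mpoly_ring_a_inv uminus_supported subset_iff)
  qed (auto intro: one_supported add_supported add_fixed_expos mult_supported)
  then show ?thesis by (rule img_is_subring)
qed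

text \<open>Since \<open>fixed_expos\<close> is closed under addition, the image of its span is a
  subring stable under scalars that contains the generators. Conversely, a competitor
  \<open>V\<close> contains each term as a scalar times a generator, hence every sum of
  terms.\<close>

lemma carrier_fixpoint_algebra:
  "carrier (fixpoint_algebra q n e) =
     residue_class q n ` (supported (fixed_expos q n e) :: 'a::field mpoly set)"
proof -
  let ?Q = "trunc_ring q n :: 'a mpoly set ring"
  let ?C = "residue_class q n ` supported (fixed_expos q n e) :: 'a mpoly set set"
  note in_var = supported_fixed_subset[OF subset_refl[of "fixed_expos q n e"]]
  have scalar: "scalar c \<in> supported (fixed_expos q n e)" for c :: 'a
    by (simp add: scalar_def single_supported)
  have "subalgebra (base_field q n) ?C ?Q"
  proof (rule subalgebra.intro)
    show "subgroup ?C (add_monoid ?Q)"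
      by (rule subring.axioms(1)[OF supported_fixed_subring])
    have "scalar c * f \<in> supported (fixed_expos q n e)" if "f \<in> supported (fixed_expos q n e)"
      for c :: 'a and f
      by (rule mult_supported[OF scalar that add_fixed_expos])
    then show "subalgebra_axioms (base_field q n) ?C ?Q"
      by (auto simp: subalgebra_axioms_def base_field_def residue_class_mult in_var scalar intro!: imageI)
  qed
  moreover have "generators q n e \<subseteq> ?C"
    by (auto simp: generators_def monomial_def fixed_expos_def var_expos_def
        intro!: imageI single_supported)
  moreover have "?C \<subseteq> V"
    if "subring V ?Q" "subalgebra (base_field q n) V ?Q" "generators q n e \<subseteq> V" for V
  proof
    fix x assume "x \<in> ?C"
    then obtain f where x: "x = residue_class q n f" and f: "f \<in> supported (fixed_expos q n e)"
      by auto
    from f have "residue_class q n f \<in> V"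
    proof (induction rule: supported_induct)
      case zero
      interpret subring V ?Q by fact
      show ?case by (simp add: residue_class_zero subgroup.one_closed[OF subring.axioms(1)[OF that(1)], simplified])
    next
      case (single a c)
      have "residue_class q n (scalar c) \<otimes>\<^bsub>?Q\<^esub> residue_class q n (monomial a) \<in> V"
      proof (rule subalgebra.smult_closed[OF that(2)])
        show "residue_class q n (monomial a) \<in> V"
          using single that(3) by (auto simp: generators_def fixed_expos_def var_expos_def)
      qed (simp add: base_field_def)
      moreover have "(monomial a :: 'a mpoly) \<in> supported (var_expos n)"
        using single fixed_expos_subset by (auto simp: monomial_def intro!: single_supported)
      ultimately show ?case
        using in_var[OF scalar, of c] by (simp add: residue_class_mult) (simp add: scalar_def monomial_def mult_single)
    next
      case (add f g)
      then show ?case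
        using subgroup.m_closed[OF subring.axioms(1)[OF that(1)], of "residue_class q n f" "residue_class q n g"]
        by (simp add: residue_class_add in_var)
    qed
    then show "x \<in> V" by (simp add: x)
  qed
  ultimately have "\<Inter>{V. subring V ?Q \<and> subalgebra (base_field q n) V ?Q \<and> generators q n e \<subseteq> V} = ?C"
    using supported_fixed_subring by (intro equalityI Inter_lower Inter_greatest) auto
  then show ?thesis by (simp add: fixpoint_algebra_def)
qed

section \<open>Radical and Loewy length\<close>

definition expo_degree :: "nat \<Rightarrow> expo \<Rightarrow> nat" where
  "expo_degree n i = (\<Sum>j = 1..n. Poly_Mapping.lookup i j)"

lemma expo_degree_add: "expo_degree n (i + j) = expo_degree n i + expo_degree n j"
  by (simp add: expo_degree_def lookup_add sum.distrib)

lemma expo_degree_pos: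
  assumes "i \<in> var_expos n" "i \<noteq> 0"
  shows "expo_degree n i > 0"
proof -
  obtain j where "Poly_Mapping.lookup i j \<noteq> 0"
    using assms(2) by (metis lookup_zero poly_mapping_eqI)
  moreover from this have "j \<in> Poly_Mapping.keys i" by (simp add: in_keys_iff)
  then have "j \<in> {1..n}" using assms(1) by (auto simp: var_expos_def)
  ultimately show ?thesis
    by (auto simp: expo_degree_def intro!: sum_pos2[where i = j])
qed

text \<open>Pigeonhole: \<open>n\<close> entries of at most \<open>q - 1\<close> add up to at most
  \<open>n * (q - 1)\<close>.\<close>

lemma large_expos_degree:
  assumes "q > 0" "i \<in> var_expos n" "n * (q - 1) < expo_degree n i"
  shows "i \<in> large_expos q n"
proof (rule ccontr)
  assume "i \<notin> large_expos q n"
  then have "Poly_Mapping.lookup i j < q" for j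
    using assms(2) unfolding large_expos_def by (simp add: not_le)
  then have "Poly_Mapping.lookup i j \<le> q - 1" for j
    using assms(1) by (metis Suc_pred' less_Suc_eq_le)
  then have "expo_degree n i \<le> n * (q - 1)"
    using sum_bounded_above[of "{1..n}" "Poly_Mapping.lookup i" "q - 1"] by (simp add: expo_degree_def)
  then show False using assms(3) by simp
qed

lemma fixpoint_algebra_simps [simp]:
  "x \<otimes>\<^bsub>fixpoint_algebra q n e\<^esub> y = x \<otimes>\<^bsub>trunc_ring q n\<^esub> y"
  "x \<oplus>\<^bsub>fixpoint_algebra q n e\<^esub> y = x \<oplus>\<^bsub>trunc_ring q n\<^esub> y"
  "\<one>\<^bsub>fixpoint_algebra q n e\<^esub> = \<one>\<^bsub>trunc_ring q n\<^esub>"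
  "\<zero>\<^bsub>fixpoint_algebra q n e\<^esub> = \<zero>\<^bsub>trunc_ring q n\<^esub>"
  by (simp_all add: fixpoint_algebra_def)

lemma fixpoint_algebra_cring: "cring (fixpoint_algebra q n e :: 'a::field mpoly set ring)"
proof -
  let ?Q = "trunc_ring q n :: 'a mpoly set ring"
  interpret Q: cring ?Q by (rule trunc_ring_cring)
  have "carrier (fixpoint_algebra q n e) = (residue_class q n ` supported (fixed_expos q n e) :: 'a mpoly set set)"
    by (rule carrier_fixpoint_algebra)
  then have "fixpoint_algebra q n e = ?Q\<lparr>carrier := residue_class q n ` supported (fixed_expos q n e)\<rparr>"
    by (simp add: fixpoint_algebra_def)
  then show ?thesis
    using Q.subcring_iff[of "residue_class q n ` supported (fixed_expos q n e)"]
      Q.subcringI'[OF supported_fixed_subring] subringE(1)[OF supported_fixed_subring]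
    by metis
qed

section \<open>The augmentation ideal as Jacobson radical\<close>

definition augmentation :: "nat \<Rightarrow> nat \<Rightarrow> nat \<Rightarrow> 'a::field mpoly set set" where
  "augmentation q n e = residue_class q n ` supported (fixed_expos q n e - {0})"

text \<open>Exponents are natural numbers, so nothing can cancel a nonzero summand; the positive
  degree of \<open>j\<close> witnesses this.\<close>

lemma fixed_expos_add_nonzero:
  assumes "i \<in> fixed_expos q n e" "j \<in> fixed_expos q n e - {0}"
  shows "i + j \<in> fixed_expos q n e - {0}"
proof -
  have "0 < expo_degree n (i + j)"
    using expo_degree_pos[of j n] assms(2) fixed_expos_subset[of q n e] by (auto simp: expo_degree_add)
  then have "i + j \<noteq> 0" by (auto simp: expo_degree_def)
  then show ?thesis using assms by (auto intro: add_fixed_expos)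
qed

lemma augmentation_ideal:
  "ideal (augmentation q n e) (fixpoint_algebra q n e :: 'a::field mpoly set ring)"
proof -
  let ?A = "fixpoint_algebra q n e :: 'a mpoly set ring"
  interpret A: cring ?A by (rule fixpoint_algebra_cring)
  note in_var = supported_fixed_subset[OF subset_refl[of "fixed_expos q n e"]]
    supported_fixed_subset[OF Diff_subset[of "fixed_expos q n e" "{0}"]]
  have sub: "augmentation q n e \<subseteq> carrier ?A"
    unfolding augmentation_def carrier_fixpoint_algebra by (intro image_mono supported_mono) auto
  have add: "x \<oplus>\<^bsub>?A\<^esub> y \<in> augmentation q n e"
    if "x \<in> augmentation q n e" "y \<in> augmentation q n e" for x y
    using that by (auto simp: augmentation_def residue_class_add in_var intro!: imageI add_supported)
  have mult: "x \<otimes>\<^bsub>?A\<^esub> y \<in> augmentation q n e"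
    if xy: "x \<in> carrier ?A" "y \<in> augmentation q n e" for x y
  proof -
    obtain f g where f: "x = residue_class q n f" "f \<in> supported (fixed_expos q n e)"
      and g: "y = residue_class q n g" "g \<in> supported (fixed_expos q n e - {0})"
      using xy by (auto simp: augmentation_def carrier_fixpoint_algebra)
    have "f * g \<in> supported (fixed_expos q n e - {0})"
      by (rule mult_supported[OF f(2) g(2) fixed_expos_add_nonzero])
    then have "residue_class q n (f * g) \<in> augmentation q n e"
      unfolding augmentation_def by (rule imageI)
    then show ?thesis
      using f g by (simp add: residue_class_mult in_var)
  qed
  show ?thesis
  proof (rule idealI)
    show "subgroup (augmentation q n e) (add_monoid ?A)"
    proof (rule A.add.subgroupI)
      show "\<ominus>\<^bsub>?A\<^esub> x \<in> augmentation q n e" if "x \<in> augmentation q n e" for x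
      proof -
        have x: "x \<in> carrier ?A" using that sub by blast
        have "\<ominus>\<^bsub>?A\<^esub> x = (\<ominus>\<^bsub>?A\<^esub> \<one>\<^bsub>?A\<^esub>) \<otimes>\<^bsub>?A\<^esub> x"
          unfolding A.l_minus[OF A.one_closed x] A.l_one[OF x] ..
        then show ?thesis using mult[OF A.a_inv_closed[OF A.one_closed] that] by simp
      qed
    qed (use sub add in \<open>auto simp: augmentation_def intro: zero_supported\<close>)
    fix x y :: "'a mpoly set" assume "x \<in> augmentation q n e" "y \<in> carrier ?A"
    with sub show "y \<otimes>\<^bsub>?A\<^esub> x \<in> augmentation q n e" "x \<otimes>\<^bsub>?A\<^esub> y \<in> augmentation q n e"
      using mult[of y x] A.m_comm[of x y] by (auto simp del: fixpoint_algebra_simps)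
  qed (rule A.ring_axioms)
qed

text \<open>The quotient is the field of constants. A strictly larger ideal would contain an element
  with nonzero constant term \<open>c\<close>; removing its other terms, which lie in the
  augmentation ideal, leaves the unit \<open>c\<close>.\<close>

lemma augmentation_maximal:
  assumes "q > 0"
  shows "maximalideal (augmentation q n e) (fixpoint_algebra q n e :: 'a::field mpoly set ring)"
proof (rule maximalidealI[OF augmentation_ideal])
  let ?A = "fixpoint_algebra q n e :: 'a mpoly set ring"
  interpret A: cring ?A by (rule fixpoint_algebra_cring)
  note in_var = supported_fixed_subset[OF subset_refl[of "fixed_expos q n e"]]
    supported_fixed_subset[OF Diff_subset[of "fixed_expos q n e" "{0}"]]
  show "carrier ?A \<noteq> augmentation q n e"
  proof
    assume "carrier ?A = augmentation q n e"
    then have "\<one>\<^bsub>?A\<^esub> \<in> augmentation q n e" using A.one_closed by simp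
    then obtain f :: "'a mpoly" where f: "f \<in> supported (fixed_expos q n e - {0})"
      and "residue_class q n 1 = residue_class q n f"
      by (auto simp: augmentation_def residue_class_one)
    then have "1 - f \<in> supported (large_expos q n)"
      using residue_class_eqD[OF assms, of 1 n f] in_var(2)[OF f] by (simp add: one_supported)
    moreover have "0 \<notin> Poly_Mapping.keys f" using f by (auto simp: supported_def)
    \<comment> \<open>The exponent 0 is not in \<open>large_expos\<close>, since
      \<open>q > 0\<close>, so this term survives truncation.\<close>
    then have "0 \<in> Poly_Mapping.keys (1 - f)" by (simp add: in_keys_iff lookup_minus)
    ultimately show False
      using assms by (auto simp: supported_def large_expos_def)
  qed
  fix K assume K: "ideal K ?A" "augmentation q n e \<subseteq> K" "K \<subseteq> carrier ?A"
  interpret K: ideal K ?A by fact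
  show "K = augmentation q n e \<or> K = carrier ?A"
  proof (rule disjCI)
    assume "K \<noteq> carrier ?A"
    have "x \<in> augmentation q n e" if "x \<in> K" for x
    proof -
      have "x \<in> carrier ?A" using \<open>x \<in> K\<close> K(3) by blast
      then obtain f where x: "x = residue_class q n f" and f: "f \<in> supported (fixed_expos q n e)"
        unfolding carrier_fixpoint_algebra by (elim imageE)
      define c where "c = Poly_Mapping.lookup f 0"
      define g where "g = f - Poly_Mapping.single 0 c"
      have sc: "Poly_Mapping.single 0 a \<in> supported (fixed_expos q n e)" for a :: 'a
        by (rule single_supported) simp
      have g: "g \<in> supported (fixed_expos q n e - {0})"
        using diff_supported[OF f sc, of c]
        by (auto simp: supported_def g_def in_keys_iff lookup_minus c_def)
      show ?thesis
      proof (cases "c = 0")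
        case True
        then show ?thesis using g x by (auto simp: augmentation_def g_def)
      next
        case False
        have "residue_class q n (- g) \<in> K"
          using K(2) g by (auto simp: augmentation_def intro!: uminus_supported)
        then have "x \<oplus>\<^bsub>?A\<^esub> residue_class q n (- g) \<in> K"
          using \<open>x \<in> K\<close> K.a_closed by blast
        then have "residue_class q n (Poly_Mapping.single 0 c) \<in> K"
          using f g by (simp add: x residue_class_add uminus_supported in_var) (simp add: g_def)
        moreover have "residue_class q n (Poly_Mapping.single 0 (inverse c)) \<in> carrier ?A"
          using sc by (auto simp: carrier_fixpoint_algebra)
        ultimately have "residue_class q n (Poly_Mapping.single 0 (inverse c)) \<otimes>\<^bsub>?A\<^esub>
            residue_class q n (Poly_Mapping.single 0 c) \<in> K"
          by (rule K.I_l_closed)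
        then have "\<one>\<^bsub>?A\<^esub> \<in> K"
          using False in_var(1)[OF sc] by (simp add: residue_class_mult mult_single residue_class_one[symmetric])
        then show ?thesis using K.one_imp_carrier \<open>K \<noteq> carrier ?A\<close> by blast
      qed
    qed
    then show "K = augmentation q n e" using K(2) by blast
  qed
qed

text \<open>Terms of \<open>f\<close> have degree at least 1, so terms of \<open>f ^ k\<close> have
  degree at least \<open>k\<close>; past \<open>n * (q - 1)\<close> they are all truncated.\<close>

lemma augmentation_nilpotent:
  fixes x :: "'a::field mpoly set"
  assumes "q > 0" "x \<in> augmentation q n e"
  shows "x [^]\<^bsub>fixpoint_algebra q n e\<^esub> Suc (n * (q - 1)) = \<zero>\<^bsub>fixpoint_algebra q n e\<^esub>"
proof -
  let ?A = "fixpoint_algebra q n e :: 'a mpoly set ring"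
  let ?D = "\<lambda>k. {i \<in> var_expos n. k \<le> expo_degree n i}"
  obtain f where x: "x = residue_class q n f" and f: "f \<in> supported (fixed_expos q n e - {0})"
    using assms(2) by (auto simp: augmentation_def)
  have "fixed_expos q n e - {0} \<subseteq> ?D 1"
    using expo_degree_pos fixed_expos_subset by (fastforce simp: Suc_le_eq)
  then have f1: "f \<in> supported (?D 1)" using f supported_mono by blast
  have sub: "supported (?D k) \<subseteq> supported (var_expos n)" for k by (rule supported_mono) auto
  have pow: "f ^ k \<in> supported (?D k) \<and> x [^]\<^bsub>?A\<^esub> k = residue_class q n (f ^ k)" for k
  proof (induction k)
    case 0
    then show ?case by (simp add: one_supported residue_class_one)
  next
    case (Suc k)
    have "f ^ k * f \<in> supported (?D (Suc k))"
      using Suc f1 by (elim conjE mult_supported) (auto simp: expo_degree_add intro: add_var_expos)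
    moreover have "residue_class q n (f ^ k) \<otimes>\<^bsub>?A\<^esub> residue_class q n f = residue_class q n (f ^ k * f)"
      unfolding fixpoint_algebra_simps
      by (rule residue_class_mult) (use Suc f1 sub in auto)
    ultimately show ?case using Suc by (simp add: x mult.commute del: fixpoint_algebra_simps)
  qed
  let ?k = "Suc (n * (q - 1))"
  have "?D ?k \<subseteq> large_expos q n"
    using large_expos_degree[OF assms(1)] by (auto simp: Suc_le_eq)
  then have "f ^ ?k \<in> supported (large_expos q n)" "f ^ ?k \<in> supported (var_expos n)"
    using pow[of ?k] sub[of ?k] supported_mono by blast+
  then show ?thesis
    using residue_class_eq_zero_iff[OF assms(1), of "f ^ ?k" n] pow[of ?k] by (simp del: power_Suc)
qed

lemma (in primeideal) nilpotent_mem: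
  assumes "x \<in> carrier R" "x [^] (k::nat) \<in> I"
  shows "x \<in> I"
  using assms(2)
proof (induction k)
  case 0
  then show ?case using I_notcarr one_imp_carrier by auto
next
  case (Suc k)
  then show ?case using I_prime[of "x [^] k" x] assms(1) by auto
qed

text \<open>Nilpotent elements lie in every prime ideal, hence in every maximal one; the reverse
  inclusion is the maximality of the augmentation ideal itself.\<close>

lemma jacobson_radical_fixpoint_algebra:
  assumes "q > 0"
  shows "jacobson_radical (fixpoint_algebra q n e) = (augmentation q n e :: 'a::field mpoly set set)"
proof -
  let ?A = "fixpoint_algebra q n e :: 'a mpoly set ring"
  interpret A: cring ?A by (rule fixpoint_algebra_cring)
  interpret N: ideal "augmentation q n e" ?A by (rule augmentation_ideal)
  have "x \<in> M" if x: "x \<in> augmentation q n e" and M: "maximalideal M ?A" for x M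
  proof -
    interpret M: primeideal M ?A by (rule A.maximalideal_prime[OF M])
    show ?thesis
      using M.nilpotent_mem[of x] augmentation_nilpotent[OF assms x] M.zero_closed N.Icarr[OF x]
      by metis
  qed
  then show ?thesis
    using augmentation_maximal[OF assms, of n e] N.Icarr by (auto simp: jacobson_radical_def)
qed

text \<open>Degrees add under multiplication, and each factor from the augmentation ideal
  contributes at least \<open>m\<close>. This filtration gives the upper bound on the Loewy
  length.\<close>

lemma ideal_power_augmentation_subset:
  assumes "\<And>i. i \<in> fixed_expos q n e \<Longrightarrow> i \<noteq> 0 \<Longrightarrow> m \<le> expo_degree n i"
  shows "ideal_power (fixpoint_algebra q n e) (augmentation q n e) l
    \<subseteq> residue_class q n ` (supported {i \<in> fixed_expos q n e. l * m \<le> expo_degree n i} :: 'a::field mpoly set)"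
proof (induction l)
  case 0
  then show ?case by (simp add: carrier_fixpoint_algebra)
next
  case (Suc l)
  let ?A = "fixpoint_algebra q n e :: 'a mpoly set ring"
  let ?D = "\<lambda>l. {i \<in> fixed_expos q n e. l * m \<le> expo_degree n i}"
  have in_var: "f \<in> supported (?D l) \<Longrightarrow> f \<in> supported (var_expos n)" for l and f :: "'a mpoly"
    by (rule supported_fixed_subset[of "?D l"]) auto
  show ?case
  proof
    fix x assume "x \<in> ideal_power ?A (augmentation q n e) (Suc l)"
    then have "x \<in> ideal_prod ?A (ideal_power ?A (augmentation q n e) l) (augmentation q n e)" by simp
    then show "x \<in> residue_class q n ` supported (?D (Suc l))"
    proof induction
      case (prod x y)
      then obtain f g where x: "x = residue_class q n f" "f \<in> supported (?D l)"
        and y: "y = residue_class q n g" "g \<in> supported (fixed_expos q n e - {0})"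
        using Suc by (auto simp: augmentation_def)
      have "f * g \<in> supported (?D (Suc l))"
      proof (rule mult_supported[OF x(2) y(2)])
        fix a b assume "a \<in> ?D l" "b \<in> fixed_expos q n e - {0}"
        then show "a + b \<in> ?D (Suc l)"
          using assms[of b] by (auto simp: expo_degree_add add_fixed_expos)
      qed
      then show ?case
        using x y in_var supported_fixed_subset[OF Diff_subset y(2)] by (simp add: residue_class_mult)
    next
      case (sum x y)
      then obtain f g where f: "x = residue_class q n f" "f \<in> supported (?D (Suc l))"
        and g: "y = residue_class q n g" "g \<in> supported (?D (Suc l))"
        by (elim imageE)
      then have "x \<oplus>\<^bsub>?A\<^esub> y = residue_class q n (f + g)"
        using in_var[OF f(2)] in_var[OF g(2)] by (simp add: residue_class_add)
      then show ?case
        using imageI[OF add_supported[OF f(2) g(2)], of "residue_class q n"] by simp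
    qed
  qed
qed

text \<open>Multiplying monomials adds exponents, so the sum of the \<open>v s\<close> is the
  exponent of a product of \<open>l\<close> elements of the augmentation ideal. Such products serve
  as witnesses that a power is nonzero.\<close>

lemma residue_monomial_ideal_power:
  assumes "\<And>s. s < l \<Longrightarrow> v s \<in> fixed_expos q n e - {0}"
  shows "(\<Sum>s<l. v s) \<in> fixed_expos q n e"
    and "residue_class q n (monomial (\<Sum>s<l. v s)) \<in>
      ideal_power (fixpoint_algebra q n e :: 'a::field mpoly set ring) (augmentation q n e) l"
proof -
  let ?A = "fixpoint_algebra q n e :: 'a mpoly set ring"
  have "(\<Sum>s<l. v s) \<in> fixed_expos q n e \<and>
    residue_class q n (monomial (\<Sum>s<l. v s)) \<in> ideal_power ?A (augmentation q n e) l"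
    using assms
  proof (induction l)
    case 0
    then show ?case by (auto simp: carrier_fixpoint_algebra monomial_def intro!: imageI one_supported)
  next
    case (Suc l)
    have v: "v l \<in> fixed_expos q n e - {0}" using Suc.prems by simp
    have "residue_class q n (monomial (v l)) \<in> (augmentation q n e :: 'a mpoly set set)"
      using v unfolding augmentation_def monomial_def by (intro imageI single_supported)
    then have "residue_class q n (monomial (\<Sum>s<l. v s)) \<otimes>\<^bsub>?A\<^esub> residue_class q n (monomial (v l))
        \<in> ideal_power ?A (augmentation q n e) (Suc l)"
      using Suc by (auto simp del: fixpoint_algebra_simps intro!: ideal_prod.prod)
    moreover have "(\<Sum>s<l. v s) \<in> var_expos n" "v l \<in> var_expos n"
      using Suc v fixed_expos_subset[of q n e] by (auto simp: subset_iff)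
    ultimately show ?case
      using Suc v by (auto simp: residue_class_mult monomial_def single_supported mult_single
          intro: add_fixed_expos)
  qed
  then show "(\<Sum>s<l. v s) \<in> fixed_expos q n e"
    and "residue_class q n (monomial (\<Sum>s<l. v s)) \<in> ideal_power ?A (augmentation q n e) l"
    by auto
qed

lemma zero_ideal_power:
  "\<zero>\<^bsub>fixpoint_algebra q n e\<^esub> \<in>
     ideal_power (fixpoint_algebra q n e :: 'a::field mpoly set ring) (augmentation q n e) l"
proof -
  let ?A = "fixpoint_algebra q n e :: 'a mpoly set ring"
  interpret A: cring ?A by (rule fixpoint_algebra_cring)
  interpret N: ideal "augmentation q n e" ?A by (rule augmentation_ideal)
  show ?thesis
  proof (induction l)
    case 0
    then show ?case using A.zero_closed by simp
  next
    case (Suc l)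
    from ideal_prod.prod[OF Suc N.zero_closed, of ?A] show ?case
      by (simp del: fixpoint_algebra_simps)
  qed
qed

text \<open>The power with exponent \<open>Suc L\<close> lives in degrees at least
  \<open>Suc L * m\<close>, beyond \<open>n * (q - 1)\<close>, and is therefore zero. The product of
  the monomials given by \<open>v\<close> lies in the power with exponent \<open>L\<close> and
  survives because all its exponents are below \<open>q\<close>.\<close>

proposition loewy_length_fixpoint_algebra:
  fixes v :: "nat \<Rightarrow> expo"
  assumes "q > 0"
    and min: "\<And>i. i \<in> fixed_expos q n e \<Longrightarrow> i \<noteq> 0 \<Longrightarrow> m \<le> expo_degree n i"
    and "n * (q - 1) < Suc L * m"
    and v: "\<And>s. s < L \<Longrightarrow> v s \<in> fixed_expos q n e - {0}"
    and small: "\<And>j. Poly_Mapping.lookup (\<Sum>s<L. v s) j < q"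
  shows "loewy_length (fixpoint_algebra q n e :: 'a::field mpoly set ring) = Suc L"
proof -
  let ?A = "fixpoint_algebra q n e :: 'a mpoly set ring"
  let ?N = "augmentation q n e :: 'a mpoly set set"
  have zero: "ideal_power ?A ?N (Suc L) = {\<zero>\<^bsub>?A\<^esub>}"
  proof -
    have "x = \<zero>\<^bsub>?A\<^esub>" if x: "x \<in> ideal_power ?A ?N (Suc L)" for x
    proof -
      obtain f where f: "x = residue_class q n f"
          "f \<in> supported {i \<in> fixed_expos q n e. Suc L * m \<le> expo_degree n i}"
        using ideal_power_augmentation_subset[of q n e m "Suc L", OF min] x by blast
      have "{i \<in> fixed_expos q n e. Suc L * m \<le> expo_degree n i} \<subseteq> large_expos q n"
      proof clarify
        fix i assume "i \<in> fixed_expos q n e" "Suc L * m \<le> expo_degree n i"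
        then show "i \<in> large_expos q n"
          using assms(3) fixed_expos_subset[of q n e] by (intro large_expos_degree[OF assms(1)]) auto
      qed
      then have "f \<in> supported (large_expos q n)" using f(2) supported_mono by blast
      moreover have "f \<in> supported (var_expos n)"
        by (rule supported_fixed_subset[OF _ f(2)]) auto
      ultimately show ?thesis
        using residue_class_eq_zero_iff[OF assms(1), of f n] f(1) by simp
    qed
    then show ?thesis using zero_ideal_power by blast
  qed
  \<comment> \<open>Minimality requires all earlier powers to be nonzero as well. Partial sums of
    \<open>v\<close> are bounded entrywise by the full sum, so their monomials survive too.\<close>
  have nonzero: "ideal_power ?A ?N l \<noteq> {\<zero>\<^bsub>?A\<^esub>}" if "l \<le> L" for l
  proof
    assume *: "ideal_power ?A ?N l = {\<zero>\<^bsub>?A\<^esub>}"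
    let ?i = "\<Sum>s<l. v s"
    have "?i \<in> fixed_expos q n e"
      and "residue_class q n (monomial ?i) \<in> ideal_power ?A ?N l"
      using v that by (auto intro!: residue_monomial_ideal_power)
    then have "(monomial ?i :: 'a mpoly) \<in> supported (large_expos q n)"
      using * fixed_expos_subset residue_class_eq_zero_iff[OF assms(1), of "monomial ?i :: 'a mpoly" n]
      by (auto simp: monomial_def single_supported subset_iff)
    then obtain j where "q \<le> Poly_Mapping.lookup ?i j"
      by (auto simp: monomial_def supported_def large_expos_def)
    also have "\<dots> \<le> Poly_Mapping.lookup (\<Sum>s<L. v s) j"
      unfolding lookup_sum using that by (intro sum_mono2) auto
    finally show False using small[of j] by simp
  qed
  show ?thesis
    unfolding loewy_length_def jacobson_radical_fixpoint_algebra[OF assms(1)]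
  proof (rule Least_equality, rule zero)
    fix l assume "ideal_power ?A ?N l = {\<zero>\<^bsub>?A\<^esub>}"
    with nonzero[of l] show "Suc L \<le> l" by (cases "l \<le> L") auto
  qed
qed

section \<open>Tilings by shifted blocks\<close>

text \<open>The shifts of the block by \<open>S\<close> cover every residue modulo \<open>n\<close>
  exactly \<open>c\<close> times, so repeating each shift \<open>(q - 1) / c\<close> times fills
  every exponent up to \<open>q - 1\<close>. A shift by \<open>s\<close> multiplies the block sum by
  \<open>q ^ s\<close> and so keeps it divisible by \<open>e\<close>.\<close>

definition block_tiling :: "nat \<Rightarrow> nat \<Rightarrow> nat \<Rightarrow> nat \<Rightarrow> bool" where
  "block_tiling q n e m \<longleftrightarrow>
     (\<exists>(S :: nat set) (b :: nat \<Rightarrow> nat) c. finite S \<and> c dvd q - 1 \<and> e dvd (\<Sum>r<m. q ^ b r) \<and>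
        (\<forall>j<n. (\<Sum>r<m. card {s \<in> S. (b r + s) mod n = j}) = c))"

lemma card_shift_mod_eq:
  fixes n b j :: nat
  assumes "j < n"
  shows "card {s. s < n \<and> (b + s) mod n = j} = 1"
proof -
  let ?f = "\<lambda>s. (b + s) mod n"
  have inj: "inj_on ?f {..<n}"
  proof (rule inj_onI)
    fix s t assume "s \<in> {..<n}" "t \<in> {..<n}" "?f s = ?f t"
    then have "[s = t] (mod n)" using cong_add_lcancel_nat[of b s t n] by (simp add: cong_def)
    then show "s = t" using \<open>s \<in> _\<close> \<open>t \<in> _\<close> by (simp add: cong_def)
  qed
  have "?f ` {..<n} = {..<n}"
    using assms by (intro endo_inj_surj inj) auto
  then have "j \<in> ?f ` {..<n}" using assms by simp
  then obtain s where s: "s < n" "?f s = j" by auto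
  then have "{s. s < n \<and> (b + s) mod n = j} = {s}"
    using inj by (auto dest: inj_onD)
  then show ?thesis by simp
qed

text \<open>Under all \<open>n\<close> shifts each single position meets every residue once, so
  \<open>m\<close> positions give multiplicity \<open>c = m\<close>.\<close>

lemma block_tiling_all_shifts:
  assumes "m dvd q - 1" "e dvd (\<Sum>r<m. q ^ b r)"
  shows "block_tiling q n e m"
  unfolding block_tiling_def
  using assms by (intro exI[of _ "{..<n}"] exI[of _ b] exI[of _ m]) (simp add: card_shift_mod_eq)

text \<open>For even \<open>n\<close>, parity survives reduction modulo \<open>n\<close>. Even
  shifts of one position meet the residues of its parity once each, so two positions of either
  parity give \<open>c = 2\<close>.\<close>

lemma block_tiling_even_shifts:
  fixes b :: "nat \<Rightarrow> nat"
  assumes "2 dvd q - 1" "even n" "e dvd (\<Sum>r<4. q ^ b r)"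
    and "even (b 0)" "even (b 1)" "odd (b 2)" "odd (b 3)"
  shows "block_tiling q n e 4"
proof -
  let ?S = "{s. s < n \<and> even s}"
  have "card {s \<in> ?S. (b r + s) mod n = j} = (if even (b r) = even j then 1 else 0)" if "j < n" for r j
  proof -
    have parity: "even ((b r + s) mod n) = (even (b r) = even s)" for s
      using \<open>even n\<close> by (simp add: dvd_mod_iff)
    show ?thesis
    proof (cases "even (b r) = even j")
      case True
      then have "{s \<in> ?S. (b r + s) mod n = j} = {s. s < n \<and> (b r + s) mod n = j}"
        using parity by auto
      then show ?thesis using True card_shift_mod_eq[OF that] by simp
    next
      case False
      then have "{s \<in> ?S. (b r + s) mod n = j} = {}"
        using parity by auto
      then show ?thesis using False by simp
    qed
  qed
  then have "(\<Sum>r<4. card {s \<in> ?S. (b r + s) mod n = j}) = 2" if "j < n" for j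
    using that assms(4-7) by (simp add: numeral_eq_Suc)
  then show ?thesis
    unfolding block_tiling_def
    using assms(1,3) by (intro exI[of _ ?S] exI[of _ b] exI[of _ 2]) simp
qed

text \<open>Windows of length \<open>m * h\<close> partition the \<open>n\<close> residues, and the
  shifts starting in the first \<open>h\<close> places of a window cover it exactly once:
  \<open>j\<close> is hit only for the index \<open>r = j mod (m * h) div h\<close>.\<close>

lemma block_tiling_progression:
  assumes "m * h dvd n" "e dvd (\<Sum>r<m. q ^ (r * h))" "n > 0"
  shows "block_tiling q n e m"
proof -
  let ?D = "m * h"
  let ?S = "{s. s < n \<and> s mod ?D < h}"
  have D: "0 < ?D" using assms(1,3) by (metis dvd_0_left gr0I less_numeral_extra(3))
  then have h: "0 < h" by simp
  \<comment> \<open>A shift starting in the first \<open>h\<close> places of its window stays in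
    that window for all \<open>r < m\<close>. As whole windows fill up \<open>n\<close>, reduction
    modulo \<open>n\<close> changes nothing.\<close>
  have no_wrap: "r * h + s < n \<and> (r * h + s) mod ?D = r * h + s mod ?D" if "s \<in> ?S" "r < m" for r s
  proof -
    have "r * h + s mod ?D < Suc r * h" using that by simp
    also have "\<dots> \<le> ?D" using that by (intro mult_le_mono1) simp
    finally have less: "r * h + s mod ?D < ?D" .
    obtain k where n: "n = ?D * k" using assms(1) by (rule dvdE)
    have "s div ?D < k" using that D n by (simp add: div_less_iff_less_mult mult.commute)
    then have "?D * (s div ?D) + ?D \<le> n"
      unfolding n using mult_le_mono2[of "Suc (s div ?D)" k ?D] by simp
    moreover have "s = ?D * (s div ?D) + s mod ?D" by simp
    ultimately have "r * h + s < n" using less by linarith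
    moreover have "(r * h + s) mod ?D = (r * h + s mod ?D) mod ?D"
      by (simp add: mod_add_right_eq)
    ultimately show ?thesis using less by simp
  qed
  have "card {s \<in> ?S. (r * h + s) mod n = j} = (if r = j mod ?D div h then 1 else 0)"
    if "j < n" "r < m" for r j
  proof (cases "r = j mod ?D div h")
    case False
    have "{s \<in> ?S. (r * h + s) mod n = j} = {}"
    proof (rule equals0I)
      fix s assume "s \<in> {s \<in> ?S. (r * h + s) mod n = j}"
      then have s: "s \<in> ?S" "(r * h + s) mod n = j" by simp_all
      have "j mod ?D = r * h + s mod ?D"
        using no_wrap[OF s(1) \<open>r < m\<close>] s(2) by auto
      moreover have "s mod ?D < h" using s(1) by simp
      ultimately have "j mod ?D div h = r" using h by simp
      then show False using False by simp
    qed
    then show ?thesis using False by simp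
  next
    case True
    have rh: "r * h \<le> j mod ?D" unfolding True by simp
    then have le: "r * h \<le> j" using mod_less_eq_dividend order_trans by blast
    \<comment> \<open>Since \<open>j mod ?D\<close> is at least \<open>r * h\<close>, the
      subtraction stays inside the window; what is left is the remainder modulo
      \<open>h\<close>.\<close>
    have "(j - r * h) mod ?D = j mod ?D - r * h"
    proof -
      have "j - r * h = ?D * (j div ?D) + (j mod ?D - r * h)"
        using rh div_mult_mod_eq[of j ?D] by (simp add: mult.commute)
      moreover have "j mod ?D - r * h < ?D" using D by (meson less_imp_diff_less mod_less_divisor)
      ultimately show ?thesis by simp
    qed
    also have "\<dots> = j mod ?D mod h" unfolding True by (simp add: minus_div_mult_eq_mod)
    also have "\<dots> < h" using h by simp
    finally have mem: "j - r * h \<in> ?S" using that by simp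
    have unique: "s = j - r * h" if s: "s \<in> ?S" "(r * h + s) mod n = j" for s
      using no_wrap[OF s(1) \<open>r < m\<close>] s(2) by auto
    have "{s \<in> ?S. (r * h + s) mod n = j} = {j - r * h}"
    proof (rule Set.set_eqI)
      fix s show "s \<in> {s \<in> ?S. (r * h + s) mod n = j} \<longleftrightarrow> s \<in> {j - r * h}"
      proof (cases "s = j - r * h")
        case True
        then show ?thesis using mem le \<open>j < n\<close> by simp
      next
        case False
        then show ?thesis using unique[of s] by (simp only: mem_Collect_eq singleton_iff) blast
      qed
    qed
    then show ?thesis using True by simp
  qed
  moreover have "j mod ?D div h < m" for j
    using D h by (simp add: div_less_iff_less_mult)
  ultimately have "(\<Sum>r<m. card {s \<in> ?S. (r * h + s) mod n = j}) = 1" if "j < n" for j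
    using that by simp
  then show ?thesis
    unfolding block_tiling_def using assms(2)
    by (intro exI[of _ ?S] exI[of _ "\<lambda>r. r * h"] exI[of _ 1]) simp
qed

section \<open>Powers of an integer congruent to 1 modulo a prime\<close>

lemma one_plus_power_cong:
  fixes x :: "'a :: unique_euclidean_ring"
  shows "[(1 + x) ^ s = 1 + of_nat s * x] (mod x ^ 2)"
proof (induction s)
  case (Suc s)
  have "[(1 + x) * (1 + x) ^ s = (1 + x) * (1 + of_nat s * x)] (mod x ^ 2)"
    using Suc by (rule cong_scalar_left)
  also have "(1 + x) * (1 + of_nat s * x) = (1 + of_nat (Suc s) * x) + of_nat s * x ^ 2"
    by (simp add: algebra_simps power2_eq_square)
  also have "[\<dots> = 1 + of_nat (Suc s) * x] (mod x ^ 2)"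
    by (simp add: cong_def)
  finally show ?case by simp
qed simp

text \<open>Modulo \<open>p ^ 2\<close>, with \<open>x = 1 + p * y\<close>, the sum is
  \<open>p\<close> plus \<open>p * y\<close> times the triangular number
  \<open>0 + ... + (p - 1)\<close>, which for odd \<open>p\<close> is itself divisible by
  \<open>p\<close>. For \<open>p = 2\<close> the sum is \<open>1 + x\<close>, and
  \<open>x = 3\<close> shows why \<open>x\<close> has to be 1 modulo 4.\<close>

lemma sum_powers_prime:
  fixes x :: int and p :: nat
  assumes "prime p" "int p dvd x - 1" "p = 2 \<Longrightarrow> 4 dvd x - 1"
  shows "\<exists>z. (\<Sum>i<p. x ^ i) = int p * (1 + int p * z)"
proof (cases "p = 2")
  case True
  then obtain y where "x - 1 = 4 * y" using assms(3) by (auto elim: dvdE)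
  then have "x = 1 + 4 * y" by simp
  then show ?thesis using True by (intro exI[of _ y]) (simp add: numeral_eq_Suc)
next
  case False
  then have "odd p" using assms(1) primes_dvd_imp_eq two_is_prime_nat by blast
  then obtain k where k: "p = 2 * k + 1" by (rule oddE)
  obtain y where "x - 1 = int p * y" using assms(2) by (auto elim: dvdE)
  then have x: "x = 1 + int p * y" by simp
  have "[x ^ i = 1 + int i * (int p * y)] (mod int p ^ 2)" for i
    using one_plus_power_cong[of "int p * y" i] unfolding x
    by (rule cong_dvd_modulus) (simp add: power_mult_distrib)
  then have "[(\<Sum>i<p. x ^ i) = (\<Sum>i<p. 1 + int i * (int p * y))] (mod int p ^ 2)"
    by (intro cong_sum)
  also have "(\<Sum>i<p. 1 + int i * (int p * y)) = int p + int (\<Sum>i<p. i) * (int p * y)"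
    by (simp add: sum.distrib sum_distrib_right)
  also have "(\<Sum>i<p. i) = p * k"
    unfolding k by (induction k) (simp_all add: algebra_simps)
  also have "int p + int (p * k) * (int p * y) = int p + int p ^ 2 * (int k * y)"
    by (simp add: power2_eq_square)
  finally have "[(\<Sum>i<p. x ^ i) = int p] (mod int p ^ 2)"
    by (simp add: cong_def)
  then obtain z where "(\<Sum>i<p. x ^ i) - int p = int p ^ 2 * z"
    by (auto simp: cong_iff_dvd_diff elim: dvdE)
  then show ?thesis by (intro exI[of _ z]) (simp add: power2_eq_square algebra_simps)
qed

text \<open>Each p-th power raises the exponent of \<open>p\<close> in \<open>x - 1\<close> by
  exactly one: the cofactor of \<open>x - 1\<close> in \<open>x ^ p - 1\<close> is \<open>p\<close>
  times a number prime to \<open>p\<close>.\<close>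

lemma lifting_exponent_prime:
  fixes x w :: int and p a :: nat
  assumes "prime p" "a \<ge> 1" "p = 2 \<Longrightarrow> a \<ge> 2" "x = 1 + int p ^ a * w" "\<not> int p dvd w"
  shows "\<exists>w'. x ^ (p ^ j) = 1 + int p ^ (a + j) * w' \<and> \<not> int p dvd w'"
proof (induction j)
  case 0
  then show ?case using assms by auto
next
  case (Suc j)
  then obtain w' where w': "x ^ (p ^ j) = 1 + int p ^ (a + j) * w'" "\<not> int p dvd w'" by blast
  let ?x = "x ^ (p ^ j)"
  have "int p dvd ?x - 1" using w' assms(2) by (simp add: dvd_power)
  moreover have "4 dvd ?x - 1" if "p = 2"
  proof -
    have "(2::int) ^ 2 dvd 2 ^ (a + j)" using assms(3)[OF that] by (intro le_imp_power_dvd) simp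
    then show ?thesis using w' that by simp
  qed
  ultimately obtain z where z: "(\<Sum>i<p. ?x ^ i) = int p * (1 + int p * z)"
    using sum_powers_prime[OF assms(1)] by blast
  have "x ^ (p ^ Suc j) - 1 = ?x ^ p - 1" by (simp add: power_mult[symmetric] mult.commute)
  also have "\<dots> = (?x - 1) * (\<Sum>i<p. ?x ^ i)" by (rule power_diff_1_eq)
  also have "\<dots> = int p ^ (a + Suc j) * (w' * (1 + int p * z))" unfolding z using w' by simp
  finally have "x ^ (p ^ Suc j) = 1 + int p ^ (a + Suc j) * (w' * (1 + int p * z))" by simp
  moreover have "\<not> int p dvd w' * (1 + int p * z)"
  proof
    assume "int p dvd w' * (1 + int p * z)"
    then have "int p dvd 1 + int p * z"
      using w'(2) assms(1) by (simp add: prime_dvd_mult_iff)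
    then have "int p dvd 1" by (simp add: dvd_add_left_iff)
    then show False using assms(1) by (simp add: prime_gt_1_nat)
  qed
  ultimately show ?case by blast
qed

text \<open>The exponent is corrected one p-adic digit at a time: a power of
  \<open>x ^ (p ^ (k - a))\<close>, which equals \<open>1 + p ^ k * v\<close> with \<open>v\<close>
  prime to \<open>p\<close>, repairs the digit at \<open>p ^ k\<close>. Thus \<open>x\<close>
  generates the units that are 1 modulo \<open>p ^ a\<close>, to any precision.\<close>

lemma principal_unit_power:
  fixes x y w :: int and p a :: nat
  assumes "prime p" "a \<ge> 1" "p = 2 \<Longrightarrow> a \<ge> 2" "x = 1 + int p ^ a * w" "\<not> int p dvd w"
    and "[y = 1] (mod int p ^ a)"
  shows "\<exists>i. [x ^ i = y] (mod int p ^ k)"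
proof (induction k)
  case (Suc k)
  show ?case
  proof (cases "Suc k \<le> a")
    case True
    then have "int p ^ Suc k dvd int p ^ a" by (rule le_imp_power_dvd)
    then have "[x ^ 0 = y] (mod int p ^ Suc k)"
      using cong_dvd_modulus[OF cong_sym[OF assms(6)]] by simp
    then show ?thesis by blast
  next
    case False
    then have "a \<le> k" "1 \<le> k" using assms(2) by auto
    from Suc obtain i where "[x ^ i = y] (mod int p ^ k)" by blast
    then obtain z where "x ^ i - y = int p ^ k * z" by (auto simp: cong_iff_dvd_diff elim: dvdE)
    then have z: "x ^ i = y + int p ^ k * z" by simp
    obtain v where v: "x ^ (p ^ (k - a)) = 1 + int p ^ k * v" "\<not> int p dvd v"
      using lifting_exponent_prime[OF assms(1-5), of "k - a"] \<open>a \<le> k\<close> by auto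
    have "int p dvd y - 1"
      using assms(2,6) dvd_trans[OF dvd_power[of a "int p"]] by (auto simp: cong_iff_dvd_diff)
    then have "\<not> int p dvd y"
      using assms(1) by (metis dvd_diff_right_iff int_dvd_int_iff nat_int_comparison(1)
          not_prime_unit of_nat_1)
    then have "coprime (v * y) (int p)"
      using v(2) assms(1) prime_imp_coprime[of "int p"] by (simp add: coprime_commute)
    then obtain s' where "[v * y * s' = 1] (mod int p)"
      using cong_solve_coprime_int by blast
    then have "[v * y * s' * (- z) = 1 * (- z)] (mod int p)" by (rule cong_scalar_right)
    then have s': "[v * y * (- z * s') = - z] (mod int p)" by (simp add: mult_ac)
    \<comment> \<open>Exponents have to be natural numbers, so the solution of the linear congruence
      is replaced by its least nonnegative residue.\<close>
    define s where "s = nat ((- z * s') mod int p)"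
    have "int s = (- z * s') mod int p"
      using assms(1) by (simp add: s_def prime_gt_0_nat)
    then have "[int s = - z * s'] (mod int p)" by (simp add: cong_def)
    then have "[v * y * int s = - z] (mod int p)"
      using s' cong_scalar_left cong_trans by blast
    then have "int p dvd v * y * int s + z" by (simp add: cong_iff_dvd_diff)
    then obtain t where t: "v * y * int s + z = int p * t" by (rule dvdE)
    \<comment> \<open>Terms with a factor \<open>p ^ (2 * k)\<close> vanish modulo
      \<open>p ^ Suc k\<close> because \<open>1 \<le> k\<close>; only the terms linear in
      \<open>p ^ k\<close> remain.\<close>
    have sq: "int p ^ Suc k dvd (int p ^ k * c) * (int p ^ k * d)" for c d
    proof -
      have "int p ^ Suc k dvd int p ^ (k + k)" using \<open>1 \<le> k\<close> by (intro le_imp_power_dvd) simp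
      also have "\<dots> dvd (int p ^ k * c) * (int p ^ k * d)" by (simp add: power_add)
      finally show ?thesis .
    qed
    have "x ^ (i + p ^ (k - a) * s) = (y + int p ^ k * z) * (1 + int p ^ k * v) ^ s"
      by (simp add: power_add power_mult z v)
    also have "[\<dots> = (y + int p ^ k * z) * (1 + int s * (int p ^ k * v))] (mod int p ^ Suc k)"
      using one_plus_power_cong[of "int p ^ k * v" s] sq[of v v]
      by (intro cong_scalar_left) (metis cong_dvd_modulus of_int_of_nat_eq of_nat_id power2_eq_square)
    also have "(y + int p ^ k * z) * (1 + int s * (int p ^ k * v)) =
        y + int p ^ k * (v * y * int s + z) + (int p ^ k * z) * (int p ^ k * (int s * v))"
      by (simp add: algebra_simps)
    also have "[\<dots> = y] (mod int p ^ Suc k)"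
      unfolding t cong_iff_dvd_diff using sq[of z "int s * v"] by (simp add: dvd_add)
    finally show ?thesis by blast
  qed
qed simp

section \<open>Zero sums of powers\<close>

text \<open>This is the lower bound for m(q,e) alone; the sum of \<open>m\<close> powers inside
  \<open>block_tiling\<close> supplies the matching upper bound in
  \<open>min_powers_eq\<close>.\<close>

definition zero_sum_bound :: "nat \<Rightarrow> nat \<Rightarrow> nat \<Rightarrow> bool" where
  "zero_sum_bound q e m \<longleftrightarrow> (\<forall>t i. 0 < t \<longrightarrow> e dvd (\<Sum>s = 1..t. q ^ i s) \<longrightarrow> m \<le> t)"

text \<open>The block takes position 0 with multiplicity \<open>m - 1\<close> and position
  \<open>i\<close> once. Modulo \<open>m\<close> every power of \<open>q\<close> is 1, so a sum of
  \<open>t\<close> powers divisible by \<open>e\<close> forces \<open>m\<close> to divide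
  \<open>t\<close>.\<close>

lemma congruent_one_tiling:
  assumes "q > 1" "m > 0" "m dvd e" "m dvd q - 1" "e dvd m - 1 + q ^ i"
  shows "block_tiling q n e m" "zero_sum_bound q e m"
proof -
  obtain m' where m: "m = Suc m'" using assms(2) gr0_implies_Suc by blast
  have "(\<Sum>r<m. q ^ (if r = 0 then i else 0)) = m - 1 + q ^ i"
    unfolding m by (subst sum.lessThan_Suc_shift) simp
  then show "block_tiling q n e m"
    using assms(4,5) by (intro block_tiling_all_shifts[where b = "\<lambda>r. if r = 0 then i else 0"]) simp_all
  show "zero_sum_bound q e m"
    unfolding zero_sum_bound_def
  proof (intro allI impI)
    fix t :: nat and j assume t: "0 < t" "e dvd (\<Sum>s = 1..t. q ^ j s)"
    have "[q = 1] (mod m)"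
      using assms(1,4) by (simp add: cong_altdef_nat)
    then have "[q ^ j s = 1] (mod m)" for s using cong_pow[of q 1 m "j s"] by simp
    then have "[(\<Sum>s = 1..t. q ^ j s) = (\<Sum>s = 1..t. 1)] (mod m)" by (intro cong_sum)
    moreover have "[(\<Sum>s = 1..t. q ^ j s) = 0] (mod m)"
      using t assms(3) by (meson cong_0_iff dvd_trans)
    ultimately have "m dvd t" by (metis cong_0_iff cong_sym cong_trans card_atLeastAtMost card_eq_sum diff_Suc_1)
    then show "m \<le> t" using t(1) by (rule dvd_imp_le)
  qed
qed

lemma trivial_modulus_tiling:
  "q > 1 \<Longrightarrow> block_tiling q n 1 1" "q > 1 \<Longrightarrow> zero_sum_bound q 1 1"
  using congruent_one_tiling[of q 1 1 0] by simp_all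

text \<open>Here \<open>\<alpha>\<close> is the smaller of \<open>k\<close> and the exponent of
  \<open>p\<close> in \<open>q - 1\<close>, so that every number that is 1 modulo
  \<open>p ^ \<alpha>\<close> is a power of \<open>q\<close> modulo \<open>p ^ k\<close>. The
  targets are those for which \<open>m = c * p ^ \<alpha>\<close> makes \<open>m - 1 + q ^ i\<close>
  divisible by \<open>p ^ k\<close>; \<open>c = 1\<close> and \<open>c = 2\<close> occur
  below.\<close>

lemma powers_of_principal_unit:
  assumes "prime p" "q > 1" "p dvd q - 1" "p = 2 \<Longrightarrow> 4 dvd q - 1"
  obtains \<alpha> where "p ^ \<alpha> dvd p ^ k" "p ^ \<alpha> dvd q - 1"
    "\<And>c. \<exists>i. [int q ^ i = 1 - int c * int p ^ \<alpha>] (mod int p ^ k)"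
proof -
  define a where "a = multiplicity p (q - 1)"
  have fin: "q - 1 \<noteq> 0" "\<not> is_unit p" using assms by auto
  obtain u where u: "q - 1 = p ^ a * u" "\<not> p dvd u"
    using multiplicity_decompose'[OF fin] unfolding a_def by blast
  have q: "int q = 1 + int p ^ a * int u"
    using u(1) assms(2) by (metis add_diff_inverse_nat less_imp_not_less of_nat_1 of_nat_add of_nat_mult of_nat_power)
  have a: "a \<ge> 1"
    using assms(3) fin by (metis a_def Suc_leI multiplicity_gt_zero_iff One_nat_def)
  have a2: "a \<ge> 2" if "p = 2"
  proof -
    have "p ^ 2 dvd q - 1" using assms(4)[OF that] that by simp
    then show ?thesis unfolding a_def using fin by (intro multiplicity_geI) auto
  qed
  have "\<exists>i. [int q ^ i = 1 - int c * int p ^ min a k] (mod int p ^ k)" for c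
  proof (cases "a \<le> k")
    case True
    have "[1 - int c * int p ^ a = 1] (mod int p ^ a)" by (simp add: cong_iff_dvd_diff)
    from principal_unit_power[OF assms(1) a a2 q _ this] u(2) True show ?thesis by simp
  next
    case False
    \<comment> \<open>Now \<open>min a k = k\<close>, so the target is 1 modulo \<open>p ^ k\<close>
      and exponent 0 suffices.\<close>
    then have "[int q ^ 0 = 1 - int c * int p ^ min a k] (mod int p ^ k)"
      by (simp add: cong_iff_dvd_diff)
    then show ?thesis by blast
  qed
  moreover have "p ^ min a k dvd q - 1" unfolding u by (simp add: dvd_mult2 le_imp_power_dvd)
  ultimately show ?thesis by (intro that[of "min a k"]) (simp_all add: le_imp_power_dvd)
qed

lemma prime_power_tiling:
  assumes "prime p" "q > 1" "p dvd q - 1" "p = 2 \<Longrightarrow> 4 dvd q - 1"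
  shows "\<exists>m>0. block_tiling q n (p ^ k) m \<and> zero_sum_bound q (p ^ k) m"
proof -
  obtain \<alpha> i where \<alpha>: "p ^ \<alpha> dvd p ^ k" "p ^ \<alpha> dvd q - 1"
    and i: "[int q ^ i = 1 - int 1 * int p ^ \<alpha>] (mod int p ^ k)"
    using powers_of_principal_unit[OF assms, of k] by metis
  have pos: "p ^ \<alpha> > 0" using assms(1) by (simp add: prime_gt_0_nat)
  have "int (p ^ \<alpha> - 1 + q ^ i) = int q ^ i - (1 - int 1 * int p ^ \<alpha>)"
    using pos by (subst of_nat_add, subst of_nat_diff) (simp_all add: Suc_le_eq)
  then have "int (p ^ k) dvd int (p ^ \<alpha> - 1 + q ^ i)"
    using i by (simp only: cong_iff_dvd_diff of_nat_power)
  then have "p ^ k dvd p ^ \<alpha> - 1 + q ^ i" by (simp only: int_dvd_int_iff)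
  then show ?thesis
    using congruent_one_tiling[OF assms(2) pos \<alpha>] pos by blast
qed

text \<open>The choice is \<open>m = 2 * p ^ \<alpha>\<close> with \<open>q ^ i\<close> congruent to
  \<open>1 - m\<close> modulo \<open>p ^ k\<close>. Modulo 2 the sum \<open>m - 1 + q ^ i\<close>
  vanishes because both parts are odd.\<close>

lemma twice_prime_power_tiling:
  assumes "prime p" "odd p" "q > 1" "2 * p dvd q - 1"
  shows "\<exists>m>0. block_tiling q n (2 * p ^ k) m \<and> zero_sum_bound q (2 * p ^ k) m"
proof -
  have dvd: "p dvd q - 1" "2 dvd q - 1" using dvd_mult_right[OF assms(4)] dvd_mult_left[OF assms(4)] by simp_all
  have odd: "odd q" using dvd(2) assms(3) by simp
  have "p = 2 \<Longrightarrow> 4 dvd q - 1" using assms(2) by simp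
  then obtain \<alpha> i where \<alpha>: "p ^ \<alpha> dvd p ^ k" "p ^ \<alpha> dvd q - 1"
    and i: "[int q ^ i = 1 - int 2 * int p ^ \<alpha>] (mod int p ^ k)"
    using powers_of_principal_unit[OF assms(1,3) dvd(1), of k] by metis
  have pos: "2 * p ^ \<alpha> > 0" using assms(1) by (simp add: prime_gt_0_nat)
  have coprime: "coprime 2 (p ^ j)" for j using assms(2) by simp
  have "int (2 * p ^ \<alpha> - 1 + q ^ i) = int q ^ i - (1 - int 2 * int p ^ \<alpha>)"
    using pos by (subst of_nat_add, subst of_nat_diff) (simp_all add: Suc_le_eq)
  then have "int (p ^ k) dvd int (2 * p ^ \<alpha> - 1 + q ^ i)"
    using i by (simp only: cong_iff_dvd_diff of_nat_power)
  then have "p ^ k dvd 2 * p ^ \<alpha> - 1 + q ^ i" by (simp only: int_dvd_int_iff)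
  moreover have "2 dvd 2 * p ^ \<alpha> - 1 + q ^ i"
    using odd pos by (simp add: even_diff_nat)
  ultimately have "2 * p ^ k dvd 2 * p ^ \<alpha> - 1 + q ^ i"
    using coprime divides_mult by blast
  moreover have "2 * p ^ \<alpha> dvd q - 1"
    using \<alpha>(2) dvd(2) coprime divides_mult by blast
  ultimately show ?thesis
    using congruent_one_tiling[OF assms(3) pos] \<alpha>(1) pos by (meson mult_dvd_mono dvd_refl)
qed

section \<open>Powers of 2 with q congruent to 3 modulo 4\<close>

lemma power_cong_parity:
  fixes x m :: nat
  assumes "[x ^ 2 = 1] (mod m)"
  shows "[x ^ i = (if even i then 1 else x)] (mod m)"
proof (cases "even i")
  case True
  then obtain j where "i = 2 * j" by (rule evenE)
  then show ?thesis using cong_pow[OF assms, of j] by (simp add: power_mult)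
next
  case False
  then obtain j where "i = 2 * j + 1" by (rule oddE)
  then show ?thesis using cong_scalar_left[OF cong_pow[OF assms, of j], of x] by (simp add: power_mult)
qed

text \<open>Let \<open>a\<close> be the exponent of 2 in \<open>q + 1\<close>. Then \<open>m\<close>
  is 1 for \<open>k = 0\<close>, it is 2 for \<open>0 < k \<le> a\<close> because
  \<open>1 + q\<close> vanishes, and 4 for \<open>a < k\<close>. In the last case
  \<open>q ^ 2\<close> generates the units that are 1 modulo \<open>2 ^ (a + 1)\<close>, while
  modulo \<open>2 ^ (a + 1)\<close> the only powers of \<open>q\<close> are 1 and \<open>q\<close>,
  so two powers never cancel.\<close>

lemma two_power_tiling:
  assumes "q > 1" "4 dvd q + 1" "2 ^ k dvd q ^ n - 1"
  shows "\<exists>m>0. block_tiling q n (2 ^ k) m \<and> zero_sum_bound q (2 ^ k) m"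
proof -
  define a where "a = multiplicity 2 (q + 1)"
  obtain u where u: "q + 1 = 2 ^ a * u" "odd u"
    using multiplicity_decompose'[of "q + 1" 2] unfolding a_def by auto
  have a: "a \<ge> 2"
    unfolding a_def using assms(2) by (intro multiplicity_geI) simp_all
  have "odd q" using assms(2) by presburger
  consider "k = 0" | "0 < k" "k \<le> a" | "a < k" by linarith
  then show ?thesis
  proof cases
    case 1
    then show ?thesis using trivial_modulus_tiling[OF assms(1)] by auto
  next
    case 2
    have two: "(2::nat) dvd 2 ^ k" using 2 by simp
    have "2 dvd q - 1" using \<open>odd q\<close> by simp
    moreover have "2 ^ k dvd q + 1" unfolding u(1) using 2 by (simp add: le_imp_power_dvd)
    then have "2 ^ k dvd 2 - 1 + q ^ 1" by simp
    ultimately have "block_tiling q n (2 ^ k) 2 \<and> zero_sum_bound q (2 ^ k) 2"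
      using congruent_one_tiling[OF assms(1) zero_less_numeral two] by blast
    then show ?thesis by (intro exI[of _ 2]) simp
  next
    case 3
    obtain v where v: "q = 2 * v + 1" using \<open>odd q\<close> by (rule oddE)
    have "odd v" using assms(2) unfolding v by presburger
    have v': "int q - 1 = 2 * int v" using v by simp
    have u': "int q + 1 = 2 ^ a * int u" using u(1) by (metis of_nat_1 of_nat_add of_nat_mult of_nat_numeral of_nat_power)
    have "int q ^ 2 - 1 = (int q - 1) * (int q + 1)" by (simp add: power2_eq_square algebra_simps)
    also have "\<dots> = 2 ^ (a + 1) * (int v * int u)" unfolding u' v' by simp
    finally have sq: "(int q)\<^sup>2 = 1 + int 2 ^ (a + 1) * (int v * int u)" by simp
    \<comment> \<open>The target \<open>- 1 - 2 * q\<close> differs from 1 by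
      \<open>- 2 * (q + 1)\<close>, so it is a power of \<open>q ^ 2\<close>; this makes
      \<open>1 + q ^ (2 * i) + 2 * q\<close> vanish modulo \<open>2 ^ k\<close>.\<close>
    have "- 1 - 2 * int q - 1 = - (2 * (int q + 1))" by simp
    also have "\<dots> = 2 ^ (a + 1) * (- int u)" unfolding u' by simp
    finally have y: "[- 1 - 2 * int q = 1] (mod int 2 ^ (a + 1))"
      by (simp add: cong_iff_dvd_diff)
    have "\<not> int 2 dvd int v * int u" using \<open>odd v\<close> u(2) by simp
    from principal_unit_power[OF two_is_prime_nat _ _ sq this y, of k] a
    obtain i where i: "[((int q)\<^sup>2) ^ i = - 1 - 2 * int q] (mod int 2 ^ k)" by auto
    \<comment> \<open>Positions 0 and \<open>2 * i\<close> are even and the odd position 1 occurs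
      twice, as the tiling by even shifts requires.\<close>
    let ?b = "\<lambda>r::nat. if r = 0 then 0 else if r = 1 then 2 * i else 1"
    have "int (\<Sum>r<4. q ^ ?b r) = ((int q)\<^sup>2) ^ i - (- 1 - 2 * int q)"
      by (simp add: numeral_eq_Suc power_mult_distrib power_add)
    then have "int (2 ^ k) dvd int (\<Sum>r<4. q ^ ?b r)"
      using i by (simp add: cong_iff_dvd_diff)
    then have block: "2 ^ k dvd (\<Sum>r<4. q ^ ?b r)" by (simp only: int_dvd_int_iff)
    have mod: "(2::nat) ^ (a + 1) dvd 2 ^ k" using 3 by (intro le_imp_power_dvd) simp
    have "(2::nat) ^ 3 dvd 2 ^ (a + 1)" using a by (intro le_imp_power_dvd) simp
    then have eight: "(8::nat) dvd 2 ^ (a + 1)" by simp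
    have "int 2 ^ (a + 1) dvd (int q)\<^sup>2 - 1" unfolding sq by simp
    then have "[int (q ^ 2) = int 1] (mod int (2 ^ (a + 1)))" by (simp add: cong_iff_dvd_diff)
    then have "[q ^ 2 = 1] (mod 2 ^ (a + 1))" by (simp only: cong_int_iff)
    note parity = power_cong_parity[OF this]
    \<comment> \<open>For odd \<open>n\<close>, \<open>q ^ n = 1\<close> would give
      \<open>q = 1\<close> modulo \<open>2 ^ (a + 1)\<close>, hence modulo 8, although
      \<open>q\<close> is 3 modulo 4.\<close>
    have "even n"
    proof (rule ccontr)
      assume "odd n"
      have "[q ^ n = 1] (mod 2 ^ (a + 1))"
        using dvd_trans[OF mod assms(3)] assms(1) by (simp add: cong_altdef_nat)
      moreover have "[q ^ n = q] (mod 2 ^ (a + 1))" using parity[of n] \<open>odd n\<close> by simp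
      ultimately have "[q = 1] (mod 2 ^ (a + 1))" using cong_sym cong_trans by blast
      then have "2 ^ (a + 1) dvd q - 1"
        using assms(1) by (simp add: cong_altdef_nat)
      then have "8 dvd q - 1" using eight dvd_trans by blast
      then show False using assms(1,2) by presburger
    qed
    have "zero_sum_bound q (2 ^ k) 4"
      unfolding zero_sum_bound_def
    proof (intro allI impI)
      fix t :: nat and i assume t: "0 < t" "2 ^ k dvd (\<Sum>s = 1..t. q ^ i s)"
      have dvd: "2 ^ (a + 1) dvd (\<Sum>s = 1..t. q ^ i s)" using mod t(2) dvd_trans by blast
      have "even (\<Sum>s = 1..t. q ^ i s)" using dvd by (meson dvd_power dvd_trans zero_less_Suc add_gr_0 less_numeral_extra(1))
      moreover have "odd (\<Sum>s = 1..t. q ^ i s) = odd t" for t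
        using \<open>odd q\<close> by (induction t) auto
      ultimately have "even t" by simp
      have "t \<noteq> 2"
      proof
        assume "t = 2"
        then have sum: "(\<Sum>s = 1..t. q ^ i s) = q ^ i 1 + q ^ i 2"
          by (simp add: numeral_eq_Suc)
        define x where "x = (if even (i 1) then 1 else q) + (if even (i 2) then 1 else q)"
        have "[q ^ i 1 + q ^ i 2 = x] (mod 2 ^ (a + 1))"
          unfolding x_def by (intro cong_add parity)
        then have x: "2 ^ (a + 1) dvd x" using dvd sum by (metis cong_dvd_iff)
        then have "8 dvd x" using eight dvd_trans by blast
        \<comment> \<open>Neither 2 nor \<open>2 * q\<close> is divisible by 8, while
          \<open>q + 1\<close> is not divisible by \<open>2 ^ (a + 1)\<close> by the choice of
          \<open>a\<close>.\<close>
        moreover have "x \<in> {2, q + 1, 2 * q}" by (auto simp: x_def)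
        ultimately have "x = q + 1" using \<open>odd q\<close> by auto
        then have "a + 1 \<le> a"
          using x unfolding a_def by (intro multiplicity_geI) simp_all
        then show False by simp
      qed
      then show "4 \<le> t" using t(1) \<open>even t\<close> by presburger
    qed
    moreover have "block_tiling q n (2 ^ k) 4"
      using block_tiling_even_shifts[of q n "2 ^ k" ?b] block \<open>even n\<close> \<open>odd q\<close> by simp
    ultimately show ?thesis by (intro exI[of _ 4]) simp
  qed
qed

section \<open>Odd primes and roots of unity among the powers of q\<close>

lemma prime_power_cong_one:
  fixes x :: int and p :: nat
  assumes "[x = 1] (mod int p)"
  shows "[x ^ (p ^ j) = 1] (mod int p ^ Suc j)"
proof (induction j)
  case (Suc j)
  let ?x = "x ^ (p ^ j)"
  have "[?x ^ i = 1] (mod int p)" for i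
    using cong_pow[OF assms, of "p ^ j * i"] by (simp add: power_mult)
  then have "[(\<Sum>i<p. ?x ^ i) = (\<Sum>i<p. 1)] (mod int p)" by (intro cong_sum)
  then have "int p dvd (\<Sum>i<p. ?x ^ i)" by (simp add: cong_def dvd_eq_mod_eq_0)
  moreover have "int p ^ Suc j dvd ?x - 1" using Suc by (simp add: cong_iff_dvd_diff)
  ultimately have "int p ^ Suc j * int p dvd (?x - 1) * (\<Sum>i<p. ?x ^ i)" by (intro mult_dvd_mono)
  also have "(?x - 1) * (\<Sum>i<p. ?x ^ i) = ?x ^ p - 1" by (rule power_diff_1_eq[symmetric])
  also have "\<dots> = x ^ (p ^ Suc j) - 1" by (simp add: power_mult[symmetric] mult.commute)
  finally show ?case by (simp add: cong_iff_dvd_diff mult.commute)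
qed (use assms in simp)

text \<open>Let \<open>D\<close> be the order of \<open>q\<close> modulo \<open>p ^ k\<close> and
  \<open>D = m * h\<close>. Then \<open>x = q ^ h\<close> satisfies \<open>x ^ m = 1\<close> modulo
  \<open>p ^ k\<close>, and since \<open>x - 1\<close> is prime to \<open>p\<close>, the geometric
  sum of the first \<open>m\<close> powers of \<open>x\<close> vanishes. The block is the
  progression with step \<open>h\<close>.\<close>

lemma root_of_unity_tiling:
  fixes p q k n m :: nat
  assumes "prime p" "odd p" "q > 1" "n > 0" "k > 0" "p ^ k dvd q ^ n - 1"
    and m: "prime m" "m dvd ord p q" "m \<noteq> p"
  shows "block_tiling q n (p ^ k) m"
proof -
  let ?e = "p ^ k"
  define d where "d = ord p q"
  define D where "D = ord ?e q"
  have qn: "[q ^ n = 1] (mod ?e)"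
    using assms(3,6) by (simp add: cong_altdef_nat)
  then have "D dvd n" by (simp only: D_def ord_divides)
  have "[q ^ D = 1] (mod ?e)" unfolding D_def by (rule ord)
  then have qD: "[q ^ D = 1] (mod p)" using assms(5) cong_dvd_modulus_nat dvd_power by blast
  then have "d dvd D" by (simp only: d_def ord_divides)
  then have "m dvd D" using m(2) d_def dvd_trans by blast
  then obtain h where h: "D = m * h" by (rule dvdE)
  have "D > 0" using \<open>D dvd n\<close> assms(4) by (simp add: dvd_pos_nat)
  \<comment> \<open>The order \<open>D\<close> divides \<open>d * p ^ (k - 1)\<close>; if
    \<open>d\<close> divided \<open>h\<close>, then \<open>m\<close> would divide a power of
    \<open>p\<close>, contrary to \<open>m \<noteq> p\<close>.\<close>
  have "\<not> d dvd h"
  proof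
    assume "d dvd h"
    then obtain y where y: "h = d * y" by (rule dvdE)
    have "[int q ^ d = 1] (mod int p)"
      using ord[of q p] cong_int_iff[of "q ^ d" 1 p] by (simp add: d_def)
    from prime_power_cong_one[OF this, of "k - 1"]
    have "[int (q ^ (d * p ^ (k - 1))) = int 1] (mod int ?e)"
      using assms(5) by (simp add: power_mult)
    then have "D dvd d * p ^ (k - 1)" unfolding D_def ord_divides[symmetric] by (simp only: cong_int_iff)
    then have "d * (m * y) dvd d * p ^ (k - 1)" unfolding h y by (simp add: mult_ac)
    moreover have "d \<noteq> 0" using y h \<open>D > 0\<close> by auto
    ultimately have "m * y dvd p ^ (k - 1)" by simp
    then have "m dvd p ^ (k - 1)" by (rule dvd_mult_left)
    then have "m dvd p" using m(1) prime_dvd_power by blast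
    then show False using m(1,3) assms(1) primes_dvd_imp_eq by blast
  qed
  then have "\<not> [q ^ h = 1] (mod p)" by (simp only: d_def ord_divides not_False_eq_True)
  let ?x = "int (q ^ h)"
  have "\<not> int p dvd ?x - 1"
    using \<open>\<not> [q ^ h = 1] (mod p)\<close> cong_int_iff[of "q ^ h" 1 p] by (simp add: cong_iff_dvd_diff)
  then have "coprime (int p) (?x - 1)" using assms(1) by (intro prime_imp_coprime) simp_all
  then have coprime: "coprime (int p ^ k) (?x - 1)" by simp
  have "[int (q ^ D) = int 1] (mod int ?e)"
    using \<open>[q ^ D = 1] (mod ?e)\<close> by (simp only: cong_int_iff)
  then have "int p ^ k dvd ?x ^ m - 1"
    unfolding h by (simp add: cong_iff_dvd_diff power_mult[symmetric] mult.commute)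
  then have "int p ^ k dvd (?x - 1) * (\<Sum>r<m. ?x ^ r)" by (simp only: power_diff_1_eq)
  then have "int p ^ k dvd (\<Sum>r<m. ?x ^ r)" using coprime coprime_dvd_mult_right_iff by blast
  then have "int ?e dvd int (\<Sum>r<m. q ^ (r * h))"
    by (simp add: power_mult[symmetric] mult.commute)
  then have "?e dvd (\<Sum>r<m. q ^ (r * h))" by (simp only: int_dvd_int_iff)
  then show ?thesis
    using \<open>D dvd n\<close> assms(4) unfolding h by (intro block_tiling_progression)
qed

text \<open>A single power of \<open>q\<close> is a unit modulo \<open>e\<close>, so it cannot
  vanish.\<close>

lemma zero_sum_bound_two:
  assumes "coprime e q" "e > 1"
  shows "zero_sum_bound q e 2"
  unfolding zero_sum_bound_def
proof (intro allI impI)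
  fix t :: nat and i assume t: "0 < t" "e dvd (\<Sum>s = 1..t. q ^ i s)"
  have "t \<noteq> 1"
  proof
    assume "t = 1"
    with t(2) have "e dvd (\<Sum>s = 1..1. q ^ i s)" by (simp only:)
    then have "e dvd q ^ i 1" by simp
    moreover have "coprime e (q ^ i 1)" using assms(1) by simp
    ultimately show False using assms(2) by (metis coprime_absorb_left nat_dvd_1_iff_1 less_irrefl)
  qed
  then show "2 \<le> t" using t(1) by simp
qed

text \<open>If two powers cancel modulo \<open>p\<close>, squaring gives
  \<open>q ^ (2 * i) = q ^ (2 * j)\<close>. As the order is odd, 2 can be cancelled in the
  exponents, whence \<open>q ^ i = q ^ j\<close> and \<open>p\<close> divides
  \<open>2 * q ^ j\<close>, which is impossible.\<close>

lemma zero_sum_bound_three: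
  fixes p q k :: nat
  assumes "prime p" "odd p" "coprime p q" "k > 0" "odd (ord p q)"
  shows "zero_sum_bound q (p ^ k) 3"
proof -
  have two: "zero_sum_bound q (p ^ k) 2"
    using assms(3) one_less_power[OF prime_gt_1_nat[OF assms(1)] assms(4)]
    by (intro zero_sum_bound_two) simp_all
  have "\<not> p ^ k dvd q ^ i + q ^ j" for i j
  proof
    assume "p ^ k dvd q ^ i + q ^ j"
    then have p: "int p dvd int q ^ i + int q ^ j"
      using assms(4) by (metis dvd_power dvd_trans int_dvd_int_iff of_nat_add of_nat_power)
    have "int (q ^ (2 * i)) - int (q ^ (2 * j)) = (int q ^ i + int q ^ j) * (int q ^ i - int q ^ j)"
      by (simp add: power_mult algebra_simps power2_eq_square mult_2 power_add)
    then have "int p dvd int (q ^ (2 * i)) - int (q ^ (2 * j))" using p by simp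
    then have "[int (q ^ (2 * i)) = int (q ^ (2 * j))] (mod int p)" by (simp only: cong_iff_dvd_diff)
    then have "[q ^ (2 * i) = q ^ (2 * j)] (mod p)" by (simp only: cong_int_iff)
    then have "[2 * i = 2 * j] (mod ord p q)"
      using order_divides_expdiff[OF assms(3)] by blast
    then have "[i = j] (mod ord p q)"
      using assms(5) cong_mult_lcancel_nat[of 2 "ord p q"] by (simp add: coprime_commute)
    then have "[q ^ i = q ^ j] (mod p)"
      using order_divides_expdiff[OF assms(3)] by blast
    then have "[int (q ^ i) = int (q ^ j)] (mod int p)" by (simp only: cong_int_iff)
    then have "int p dvd int q ^ i - int q ^ j" by (simp add: cong_iff_dvd_diff)
    from dvd_diff[OF p this] have "int p dvd int (2 * q ^ j)" by simp
    then have "p dvd 2 * q ^ j" by (simp only: int_dvd_int_iff)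
    moreover have "coprime p (2 * q ^ j)" using assms(2,3) by simp
    ultimately show False using assms(1) by (metis coprime_absorb_left not_prime_unit)
  qed
  then have "t \<noteq> 2" if "p ^ k dvd (\<Sum>s = 1..t. q ^ i s)" for t and i :: "nat \<Rightarrow> nat"
    using that by (auto simp: numeral_eq_Suc)
  then show ?thesis
    using two unfolding zero_sum_bound_def by (metis le_neq_implies_less Suc_leI eval_nat_numeral(3) numeral_2_eq_2)
qed

text \<open>The order of \<open>q\<close> modulo \<open>p\<close> divides
  \<open>p - 1 = 2 ^ a * 3 ^ b\<close>, so it is 1, even, or an odd multiple of 3. Order 1 is the
  case of principal units treated before; in the other two cases \<open>m\<close> is 2 or 3, and
  roots of unity give the block.\<close>

lemma pierpont_tiling:
  fixes p q k n :: nat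
  assumes "pierpont_prime p" "odd p" "q > 1" "n > 0" "p ^ k dvd q ^ n - 1"
  shows "\<exists>m>0. block_tiling q n (p ^ k) m \<and> zero_sum_bound q (p ^ k) m"
proof (cases "k = 0")
  case True
  then show ?thesis using trivial_modulus_tiling[OF assms(3)] by auto
next
  case False
  then have "k > 0" by simp
  obtain a b where p: "prime p" "p = 1 + 2 ^ a * 3 ^ b"
    using assms(1) by (auto simp: pierpont_prime_def)
  have "[q ^ n = 1] (mod p ^ k)" using assms(3,5) by (simp add: cong_altdef_nat)
  then have "coprime (q ^ n) (p ^ k)" by (metis cong_imp_coprime cong_sym coprime_1_left)
  then have coprime: "coprime p q" using assms(4) \<open>k > 0\<close> by (simp add: coprime_commute)
  then have "\<not> p dvd q" using p(1) by (metis coprime_absorb_left not_prime_unit)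
  then have "[q ^ (p - 1) = 1] (mod p)" using p(1) by (intro fermat_theorem)
  then have "ord p q dvd p - 1" by (simp only: ord_divides)
  then have d: "ord p q dvd 2 ^ a * 3 ^ b" using p(2) by simp
  show ?thesis
  proof (cases "ord p q = 1")
    case True
    then have "[q = 1] (mod p)" using ord[of q p] by simp
    then have "p dvd q - 1" using assms(3) by (simp add: cong_altdef_nat)
    moreover have "p = 2 \<Longrightarrow> 4 dvd q - 1" using assms(2) by simp
    ultimately show ?thesis by (rule prime_power_tiling[OF p(1) assms(3)])
  next
    case False
    then obtain m where m: "prime m" "m dvd ord p q" by (meson prime_factor_nat)
    then have "m dvd 2 ^ a * 3 ^ b" using d dvd_trans by blast
    then have "m dvd 2 \<or> m dvd 3" using m(1) prime_dvd_mult_iff prime_dvd_power by metis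
    then have "m \<le> 2 \<or> m \<le> 3" by (auto dest: dvd_imp_le)
    then have m23: "m = 2 \<or> m = 3" using prime_ge_2_nat[OF m(1)] by linarith
    show ?thesis
    proof (cases "even (ord p q)")
      case True
      have "block_tiling q n (p ^ k) 2"
        using assms p(1) \<open>k > 0\<close> True by (intro root_of_unity_tiling) auto
      moreover have "zero_sum_bound q (p ^ k) 2"
        using coprime one_less_power[OF prime_gt_1_nat[OF p(1)] \<open>k > 0\<close>]
        by (intro zero_sum_bound_two) simp_all
      ultimately show ?thesis by (intro exI[of _ 2]) simp
    next
      case odd: False
      then have "m = 3" using m23 m(2) by auto
      \<comment> \<open>The tiling by roots of unity needs \<open>m\<close> and \<open>p\<close>
        distinct. For \<open>p = 3\<close> the order divides 2 and could not be a multiple of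
        3.\<close>
      have "p \<noteq> 3"
      proof
        assume "p = 3"
        then have "ord p q dvd 2" using \<open>ord p q dvd p - 1\<close> by simp
        then have "ord p q \<le> 2" by (rule dvd_imp_le) simp
        moreover have "3 \<le> ord p q" using m(2) \<open>m = 3\<close> odd_pos[OF odd] dvd_imp_le by blast
        ultimately show False by simp
      qed
      then have "block_tiling q n (p ^ k) 3"
        using assms p(1) \<open>k > 0\<close> m \<open>m = 3\<close> by (intro root_of_unity_tiling) auto
      moreover have "zero_sum_bound q (p ^ k) 3"
        using p(1) assms(2) coprime \<open>k > 0\<close> odd by (rule zero_sum_bound_three)
      ultimately show ?thesis by (intro exI[of _ 3]) simp
    qed
  qed
qed

section \<open>From tilings to the Loewy length\<close>

text \<open>An exponent vector is read as a list of powers of \<open>q\<close>, with position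
  \<open>w j\<close> repeated \<open>c j\<close> times; this turns its weight into a sum of the kind
  bounded by \<open>zero_sum_bound\<close>.\<close>

lemma degree_as_power_sum:
  fixes c w :: "'b \<Rightarrow> nat"
  assumes "finite A"
  shows "\<exists>i. (\<Sum>s = 1..(\<Sum>j\<in>A. c j). q ^ i s) = (\<Sum>j\<in>A. q ^ w j * c j)"
  using assms
proof (induction A rule: finite_induct)
  case (insert a A)
  let ?t = "\<Sum>j\<in>A. c j"
  obtain i where i: "(\<Sum>s = 1..?t. q ^ i s) = (\<Sum>j\<in>A. q ^ w j * c j)" using insert.IH by blast
  let ?i = "\<lambda>s. if s \<le> ?t then i s else w a"
  have "(\<Sum>s = 1..?t + c a. q ^ ?i s) = (\<Sum>s = 1..?t. q ^ ?i s) + (\<Sum>s = Suc ?t..?t + c a. q ^ ?i s)"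
    by (simp add: sum.ub_add_nat)
  also have "\<dots> = (\<Sum>j\<in>A. q ^ w j * c j) + q ^ w a * c a"
    using i by simp
  finally show ?case
    using insert by (intro exI[of _ ?i]) (simp add: add.commute)
qed simp

lemma min_powers_eq:
  assumes "m > 0" "zero_sum_bound q e m" "e dvd (\<Sum>r<m. q ^ b r)"
  shows "min_powers q e = m"
  unfolding min_powers_def
proof (rule Least_equality)
  have "(\<Sum>s = 1..m. q ^ b (s - 1)) = (\<Sum>r<m. q ^ b r)"
    using sum.atLeast1_atMost_eq[of "\<lambda>s. q ^ b (s - 1)" m] by simp
  then show "0 < m \<and> (\<exists>i. e dvd (\<Sum>s = 1..m. q ^ i s))"
    using assms(1,3) by (intro conjI exI[of _ "\<lambda>s. b (s - 1)"]) simp_all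
qed (use assms(2) in \<open>auto simp: zero_sum_bound_def\<close>)

lemma fixed_expos_min_degree:
  assumes "zero_sum_bound q e m" "i \<in> fixed_expos q n e" "i \<noteq> 0"
  shows "m \<le> expo_degree n i"
proof -
  obtain x where "(\<Sum>s = 1..expo_degree n i. q ^ x s) = (\<Sum>j = 1..n. q ^ (j - 1) * Poly_Mapping.lookup i j)"
    using degree_as_power_sum[of "{1..n}" q "Poly_Mapping.lookup i" "\<lambda>j. j - 1"]
    unfolding expo_degree_def by blast
  moreover have "e dvd (\<Sum>j = 1..n. q ^ (j - 1) * Poly_Mapping.lookup i j)"
    using assms(2) unfolding fixed_expos_def by (simp add: cong_0_iff)
  moreover have "0 < expo_degree n i"
    using assms(2,3) fixed_expos_subset by (intro expo_degree_pos) auto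
  ultimately show ?thesis using assms(1) unfolding zero_sum_bound_def by metis
qed

text \<open>Positions count from 0 and matter only modulo \<open>n\<close>, because
  \<open>q ^ n\<close> is 1 modulo \<open>e\<close> in all uses; variable indices start at 1, whence
  the \<open>Suc\<close>.\<close>

definition block_expo :: "nat \<Rightarrow> nat \<Rightarrow> (nat \<Rightarrow> nat) \<Rightarrow> expo" where
  "block_expo n m b = (\<Sum>r<m. Poly_Mapping.single (Suc (b r mod n)) 1)"

lemma lookup_block_expo:
  "Poly_Mapping.lookup (block_expo n m b) j = (\<Sum>r<m. if Suc (b r mod n) = j then 1 else 0)"
  by (simp add: block_expo_def lookup_sum lookup_single when_def del: One_nat_def)

lemma block_expo_fixed:
  assumes "n > 0" "m > 0" "q > 0" "e dvd q ^ n - 1" "e dvd (\<Sum>r<m. q ^ b r)"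
  shows "block_expo n m b \<in> fixed_expos q n e - {0}"
proof -
  have "(\<Sum>j = 1..n. q ^ (j - 1) * Poly_Mapping.lookup (block_expo n m b) j)
      = (\<Sum>r<m. \<Sum>j = 1..n. if Suc (b r mod n) = j then q ^ (j - 1) else 0)"
    unfolding lookup_block_expo sum_distrib_left
    by (subst sum.swap) (intro sum.cong refl, simp)
  also have "\<dots> = (\<Sum>r<m. q ^ (b r mod n))"
    using assms(1) by (intro sum.cong refl) (simp add: Suc_le_eq)
  finally have weight: "(\<Sum>j = 1..n. q ^ (j - 1) * Poly_Mapping.lookup (block_expo n m b) j)
      = (\<Sum>r<m. q ^ (b r mod n))" .
  have "[q ^ n = 1] (mod e)" using assms(3,4) by (simp add: cong_altdef_nat)
  then have one: "[(q ^ n) ^ (b r div n) = 1] (mod e)" for r using cong_pow[of "q ^ n" 1 e] by simp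
  have "[q ^ (b r mod n) = q ^ b r] (mod e)" for r
  proof -
    have "q ^ b r = (q ^ n) ^ (b r div n) * q ^ (b r mod n)"
      by (metis mult_div_mod_eq power_add power_mult)
    then show ?thesis
      using cong_scalar_right[OF one[of r], of "q ^ (b r mod n)"] by (simp add: cong_sym)
  qed
  then have "[(\<Sum>r<m. q ^ (b r mod n)) = (\<Sum>r<m. q ^ b r)] (mod e)" by (intro cong_sum)
  then have "[(\<Sum>r<m. q ^ (b r mod n)) = 0] (mod e)"
    using assms(5) by (meson cong_0_iff cong_trans)
  moreover have "j \<in> {1..n}" if "j \<in> Poly_Mapping.keys (block_expo n m b)" for j
  proof -
    have "\<exists>r<m. Suc (b r mod n) = j"
      using that by (auto simp: in_keys_iff lookup_block_expo split: if_splits)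
    then show ?thesis using assms(1) by (auto simp: Suc_le_eq)
  qed
  moreover have "block_expo n m b \<noteq> 0"
  proof
    assume "block_expo n m b = 0"
    \<comment> \<open>The entry at the first position of the block is inspected; that position
      exists because \<open>m > 0\<close>.\<close>
    then have "(\<Sum>r<m. if Suc (b r mod n) = Suc (b 0 mod n) then 1 else 0 :: nat) = 0"
      using lookup_block_expo[of n m b "Suc (b 0 mod n)"] by simp
    then have "(if Suc (b 0 mod n) = Suc (b 0 mod n) then 1 else 0 :: nat) = 0"
      using assms(2) by (subst (asm) sum_eq_0_iff) blast+
    then show False by simp
  qed
  ultimately show ?thesis
    unfolding fixed_expos_def var_expos_def mem_Collect_eq Diff_iff weight by blast
qed

text \<open>Counting covered residues in two ways gives \<open>m * card S = n * c\<close>. Using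
  each shift \<open>f = (q - 1) / c\<close> times yields exactly \<open>L = n * (q - 1) / m\<close>
  vectors, and each entry of their sum is at most \<open>f * c = q - 1\<close>. As \<open>m\<close>
  divides \<open>n * (q - 1)\<close>, the floor is exact.\<close>

proposition loewy_length_of_tiling:
  fixes q n e :: nat
  assumes "q > 1" "n > 0" "e dvd q ^ n - 1" "m > 0" "block_tiling q n e m" "zero_sum_bound q e m"
  shows "int (loewy_length (fixpoint_algebra q n e :: 'a::field mpoly set ring))
       = \<lfloor>real (n * (q - 1)) / real (min_powers q e)\<rfloor> + 1"
proof -
  obtain S :: "nat set" and b c where S: "finite S" "c dvd q - 1" "e dvd (\<Sum>r<m. q ^ b r)"
    and cover: "\<And>j. j < n \<Longrightarrow> (\<Sum>r<m. card {s \<in> S. (b r + s) mod n = j}) = c"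
    using assms(5) unfolding block_tiling_def by blast
  obtain f where f: "q - 1 = c * f" using S(2) by (rule dvdE)
  have "card S = (\<Sum>j<n. card {s \<in> S. (b r + s) mod n = j})" for r
    using sum.group[of S "{..<n}" "\<lambda>s. (b r + s) mod n" "\<lambda>_. 1 :: nat"] S(1) assms(2)
    by (simp add: image_subset_iff)
  then have "m * card S = (\<Sum>r<m. \<Sum>j<n. card {s \<in> S. (b r + s) mod n = j})" by simp
  also have "\<dots> = (\<Sum>j<n. \<Sum>r<m. card {s \<in> S. (b r + s) mod n = j})" by (rule sum.swap)
  also have "\<dots> = n * c" using cover by simp
  finally have card_S: "m * card S = n * c" .
  \<comment> \<open>The second component only labels the \<open>f\<close> copies of a shift.\<close>
  define T where "T = S \<times> {..<f}"
  define L where "L = card T"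
  have "finite T" using S(1) by (simp add: T_def)
  have L: "n * (q - 1) = L * m"
    unfolding L_def T_def f using card_S by (simp add: card_cartesian_product mult_ac)
  let ?v = "\<lambda>(s, u). block_expo n m (\<lambda>r. b r + s)"
  obtain h where h: "bij_betw h {..<L} T"
    using ex_bij_betw_nat_finite[OF \<open>finite T\<close>] by (auto simp: L_def atLeast0LessThan)
  have v: "?v t \<in> fixed_expos q n e - {0}" for t
  proof -
    have "e dvd q ^ fst t * (\<Sum>r<m. q ^ b r)" using S(3) by simp
    also have "\<dots> = (\<Sum>r<m. q ^ (b r + fst t))" by (simp add: sum_distrib_left power_add mult.commute)
    finally show ?thesis
      unfolding case_prod_beta using assms(1-4) by (intro block_expo_fixed) simp_all
  qed
  have "Poly_Mapping.lookup (\<Sum>s<L. ?v (h s)) j < q" for j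
  proof -
    have "Poly_Mapping.lookup (\<Sum>s<L. ?v (h s)) j = (\<Sum>t\<in>T. Poly_Mapping.lookup (?v t) j)"
      unfolding lookup_sum by (rule sum.reindex_bij_betw[OF h])
    also have "\<dots> = (\<Sum>s\<in>S. f * Poly_Mapping.lookup (block_expo n m (\<lambda>r. b r + s)) j)"
      unfolding T_def by (simp add: sum.cartesian_product')
    also have "\<dots> = f * (\<Sum>s\<in>S. \<Sum>r<m. if Suc ((b r + s) mod n) = j then 1 else 0)"
      by (simp add: sum_distrib_left lookup_block_expo)
    also have "\<dots> = f * (\<Sum>r<m. \<Sum>s\<in>S. if Suc ((b r + s) mod n) = j then 1 else 0)"
      by (subst sum.swap) simp
    also have "\<dots> = f * (\<Sum>r<m. card {s \<in> S. Suc ((b r + s) mod n) = j})"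
      using S(1) by (simp add: sum.If_cases Int_def)
    also have "\<dots> \<le> f * c"
    proof (cases "j \<in> {1..n}")
      case True
      then obtain j' where "j = Suc j'" "j' < n" by (cases j) auto
      then show ?thesis using cover[of j'] by simp
    next
      case False
      \<comment> \<open>Indices outside \<open>{1..n}\<close> belong to no variable and are never
        hit.\<close>
      have "{s \<in> S. Suc ((b r + s) mod n) = j} = {}" for r
        using False assms(2) by (auto simp: Suc_le_eq)
      then show ?thesis by (simp only: card.empty sum.neutral_const)
    qed
    also have "\<dots> < q" using f assms(1) by (simp add: mult.commute)
    finally show ?thesis .
  qed
  then have "loewy_length (fixpoint_algebra q n e :: 'a mpoly set ring) = Suc L"
    using fixed_expos_min_degree[OF assms(6)] v assms(1,4) L
    by (intro loewy_length_fixpoint_algebra[where m = m and v = "\<lambda>s. ?v (h s)"]) simp_all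
  moreover have "\<lfloor>real (n * (q - 1)) / real m\<rfloor> = int L"
    unfolding L using assms(4) by simp
  ultimately show ?thesis
    using min_powers_eq[OF assms(4,6) S(3)] by simp
qed

theorem theorem4p3:
  fixes q n e :: nat
  assumes "q > 1" and "n > 0" and "e > 0" and "e dvd q ^ n - 1"
    and "(\<exists>p k :: nat. prime p \<and> odd p \<and> k > 0 \<and> e = p ^ k \<and> [q = 1] (mod p))
       \<or> (\<exists>p k :: nat. prime p \<and> odd p \<and> k > 0 \<and> e = 2 * p ^ k \<and> [q = 1] (mod (2 * p)))
       \<or> (\<exists>p k :: nat. pierpont_prime p \<and> odd p \<and> e = p ^ k)
       \<or> (\<exists>k :: nat. e = 2 ^ k)"
  shows "int (loewy_length (fixpoint_algebra q n e :: 'a::field mpoly set ring))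
       = \<lfloor>real (n * (q - 1)) / real (min_powers q e)\<rfloor> + 1"
proof -
  have "\<exists>m>0. block_tiling q n e m \<and> zero_sum_bound q e m"
    using assms(5)
  proof (elim disjE exE conjE)
    fix p k assume p: "prime p" "odd p" "e = p ^ k" "[q = 1] (mod p)"
    have "p dvd q - 1" using cong_to_1_nat[OF p(4)] .
    moreover have "p = 2 \<Longrightarrow> 4 dvd q - 1" using p(2) by simp
    ultimately show ?thesis
      unfolding p(3) by (rule prime_power_tiling[OF p(1) assms(1)])
  next
    fix p k assume p: "prime p" "odd p" "e = 2 * p ^ k" "[q = 1] (mod (2 * p))"
    show ?thesis
      unfolding p(3) using cong_to_1_nat[OF p(4)]
      by (rule twice_prime_power_tiling[OF p(1,2) assms(1)])
  next
    fix p k assume p: "pierpont_prime p" "odd p" "e = p ^ k"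
    show ?thesis
      unfolding p(3) using pierpont_tiling[OF p(1,2) assms(1,2)] assms(4) p(3) by blast
  next
    fix k :: nat assume e: "e = 2 ^ k"
    show ?thesis
    \<comment> \<open>The exponent 0 is separated because only a positive \<open>k\<close> makes
      \<open>e\<close> even and hence \<open>q\<close> odd.\<close>
    proof (cases "k = 0")
      case True
      then show ?thesis using trivial_modulus_tiling[OF assms(1)] e by auto
    next
      case False
      then have "even (q ^ n - 1)" using assms(4) e by (metis dvd_power dvd_trans gr0I)
      then have "odd q" using assms(1,2) by (auto simp: even_diff_nat split: if_splits)
      \<comment> \<open>If \<open>q\<close> is 1 modulo 4, it is a principal unit for the prime 2
        and the argument for prime powers applies; the residue 3 is the case of
        \<open>two_power_tiling\<close>.\<close>
      then have "4 dvd q - 1 \<or> 4 dvd q + 1" by presburger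
      then show ?thesis
      proof
        assume four: "4 dvd q - 1"
        then have "2 dvd q - 1" by presburger
        then show ?thesis unfolding e using four by (intro prime_power_tiling[OF two_is_prime_nat assms(1)])
      next
        assume "4 dvd q + 1"
        then show ?thesis unfolding e using assms(4) e by (intro two_power_tiling[OF assms(1)]) simp_all
      qed
    qed
  qed
  then show ?thesis using loewy_length_of_tiling[OF assms(1,2,4)] by blast
qed

end
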